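(* Let $\sigma\in\mathbb R$, let $V:\mathbb R\to\mathbb R$ be smooth, and let $\hat u(z,k)$ be a family of nonconstant functions, $2\pi$-periodic in $z$ and depending smoothly on $(z,k)$ for $k$ in an open interval of nonzero real numbers, such that $k^4\hat u_{zzzz}+\sigma k^2\hat u_{zz}+V'(\hat u)=0$ for each $k$. Set $A(k)=\frac1{2\pi}\int_0^{2\pi}(\sigma k\hat u_z^2-2k^3\hat u_{zz}^2)\,dz$. For fixed $k$ consider, on $2\pi$-periodic functions of $z$, the polynomial operator family $$\mathbf L(\lambda)v=\Big(\lambda+k\frac{\partial}{\partial z}\Big)^4v+\sigma\Big(\lambda+k\frac{\partial}{\partial z}\Big)^2v+V''(\hat u)v .$$ Suppose $\lambda=0$ is an eigenvalue of geometric multiplicity one, i.e. the kernel of $\mathbf L(0)$ on $2\pi$-periodic functions is spanned by $\hat u_z$. Then: 1. the algebraic multiplicity of the eigenvalue $\lambda=0$ is at least two; 2. the algebraic multiplicity is at least three if and only if $A_k=0$ at this value of $k$; 3. if the algebraic multiplicity is at least three, then it is at least four.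
   Context: Algebraic multiplicity for an eigenvalue problem that is nonlinear in the parameter: for an eigenvalue $\lambda_*$ of $\mathbf L(\lambda)$ of geometric multiplicity one, a Jordan chain of length $m$ is a sequence $\xi_1,\dots,\xi_m$ of smooth $2\pi$-periodic functions with $\xi_1\neq0$ and $$\mathbf L(\lambda_* )\xi_{j}=-\sum_{i=1}^{j-1}\frac1{i!}\mathbf L^{(i)}(\lambda_* )\xi_{j-i},\qquad j=1,\dots,m,$$ where $\mathbf L^{(i)}$ is the $i$-th derivative with respect to $\lambda$ (so $\mathbf L(\lambda_* )\xi_1=0$). The algebraic multiplicity is the maximal length of a Jordan chain. Here $\lambda_*=0$, and one may take $\xi_1=\hat u_z$. Subscript $k$ denotes the derivative with respect to $k$. *)

theory Defs
  imports "HOL-Analysis.Analysis" "HOL-Library.Extended_Nat"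
begin

text \<open>Functions of class \<open>C\<^sup>n\<close> on an open set, through iterated directional derivatives.\<close>

primrec C_n_on :: "nat \<Rightarrow> 'a::real_normed_vector set \<Rightarrow> ('a \<Rightarrow> 'b::real_normed_vector) \<Rightarrow> bool"
  where
    "C_n_on 0 S f \<longleftrightarrow> continuous_on S f"
  | "C_n_on (Suc n) S f \<longleftrightarrow>
       (\<forall>x\<in>S. f differentiable (at x)) \<and>
       (\<forall>v. C_n_on n S (\<lambda>x. frechet_derivative f (at x) v))"

definition smooth_on :: "'a::real_normed_vector set \<Rightarrow> ('a \<Rightarrow> 'b::real_normed_vector) \<Rightarrow> bool"
  where "smooth_on S f \<longleftrightarrow> (\<forall>n. C_n_on n S f)"

definition smooth_periodic :: "(real \<Rightarrow> complex) \<Rightarrow> bool"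
  where "smooth_periodic v \<longleftrightarrow> smooth_on UNIV v \<and> (\<forall>z. v (z + 2 * pi) = v z)"

type_synonym operator_family = "complex \<Rightarrow> (real \<Rightarrow> complex) \<Rightarrow> real \<Rightarrow> complex"

definition periodic_kernel :: "((real \<Rightarrow> complex) \<Rightarrow> real \<Rightarrow> complex) \<Rightarrow> (real \<Rightarrow> complex) set"
  where "periodic_kernel T = {v. smooth_periodic v \<and> (\<forall>z. T v z = 0)}"

text \<open>The \<open>i\<close>-th derivative of an operator family with respect to the parameter is taken
  pointwise: \<open>v\<close> and \<open>z\<close> are held fixed.\<close>

definition param_deriv :: "nat \<Rightarrow> operator_family \<Rightarrow> operator_family"
  where "param_deriv i L lam v z = (deriv ^^ i) (\<lambda>\<mu>. L \<mu> v z) lam"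

text \<open>Only the entries \<open>\<xi> 1, \<dots>, \<xi> m\<close> of the sequence are relevant.\<close>

definition jordan_chain ::
    "operator_family \<Rightarrow> complex \<Rightarrow> nat \<Rightarrow> (nat \<Rightarrow> real \<Rightarrow> complex) \<Rightarrow> bool"
  where "jordan_chain L lam m \<xi> \<longleftrightarrow>
    m \<ge> 1 \<and> (\<forall>j\<in>{1..m}. smooth_periodic (\<xi> j)) \<and> \<xi> 1 \<noteq> (\<lambda>z. 0) \<and>
    (\<forall>j\<in>{1..m}. \<forall>z. L lam (\<xi> j) z =
       - (\<Sum>i=1..j-1. 1 / fact i * param_deriv i L lam (\<xi> (j - i)) z))"

text \<open>The multiplicity is \<open>\<infinity>\<close> if there are arbitrarily long Jordan chains. The definition
  is meant for eigenvalues of geometric multiplicity one.\<close>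

definition alg_mult :: "operator_family \<Rightarrow> complex \<Rightarrow> enat"
  where "alg_mult L lam = Sup {enat m | m. \<exists>\<xi>. jordan_chain L lam m \<xi>}"

definition shifted_deriv :: "real \<Rightarrow> complex \<Rightarrow> (real \<Rightarrow> complex) \<Rightarrow> real \<Rightarrow> complex"
  where "shifted_deriv k lam v z = lam * v z + of_real k * vector_derivative v (at z)"

definition L_op :: "real \<Rightarrow> (real \<Rightarrow> real) \<Rightarrow> (real \<Rightarrow> real \<Rightarrow> real) \<Rightarrow> real \<Rightarrow> operator_family"
  where "L_op \<sigma> V u k lam v z =
    (shifted_deriv k lam ^^ 4) v z + of_real \<sigma> * (shifted_deriv k lam ^^ 2) v z
    + of_real ((deriv ^^ 2) V (u z k)) * v z"

definition action :: "real \<Rightarrow> (real \<Rightarrow> real \<Rightarrow> real) \<Rightarrow> real \<Rightarrow> real"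
  where "action \<sigma> u k = 1 / (2 * pi) * integral {0..2 * pi}
    (\<lambda>z. \<sigma> * k * (deriv (\<lambda>z. u z k) z)\<^sup>2 - 2 * k ^ 3 * ((deriv ^^ 2) (\<lambda>z. u z k) z)\<^sup>2)"

end

theory Submission
  imports Defs
begin

text \<open>
Write the pencil as \<open>L0 + \<lambda> L1 + \<lambda>\<^sup>2 L2 + \<lambda>\<^sup>3 L3 + \<lambda>\<^sup>4\<close>. The coefficients \<open>L0\<close>, \<open>L2\<close> contain only even powers
of \<open>d/dz\<close> and are symmetric for the bilinear pairing \<open>\<langle>f, g\<rangle> = \<integral> f g\<close> over a period; \<open>L1\<close>, \<open>L3\<close> contain
only odd powers and are skew. Let \<open>\<phi>\<close> and \<open>\<psi>\<close> be the \<open>z\<close>-derivative and the \<open>k\<close>-derivative of the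
profile. Differentiating the profile equation in \<open>k\<close> gives \<open>L0 \<psi> = - L1 \<phi>\<close>, so \<open>\<phi>, \<psi>\<close> is a Jordan
chain of length two.

A third element has to solve \<open>L0 \<zeta> = - L1 \<psi> - L2 \<phi>\<close>. By the Fredholm alternative this is possible
if and only if \<open>\<langle>\<phi>, L1 \<psi>\<rangle> + \<langle>\<phi>, L2 \<phi>\<rangle> = 0\<close>, and an integration by parts identifies the left-hand side
with \<open>2 \<pi>\<close> times the derivative of the action (\<open>solvability_by_parts\<close>, \<open>action_has_derivative\<close>).
The necessity for chains other than the one started by \<open>\<phi>, \<psi>\<close> is \<open>chain_obstruction\<close>. The
solvability condition for the fourth element then holds identically, because of the alternation
between symmetric and skew coefficients (\<open>chain_extension\<close>).

The analytic ingredient is the sufficiency of the orthogonality condition for solving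
\<open>L0 v = f\<close> among smooth periodic functions (\<open>fredholm_alternative\<close>). It is reduced to linear algebra
on the four-dimensional space of jets through the global solvability of linear differential
equations (\<open>lipschitz_ode_global_solution\<close>): a solution is periodic when its jet returns after one
period, and Lagrange's identity describes the increments that can occur.
\<close>

section \<open>Global solutions of Lipschitz differential equations\<close>

lemma antiderivative_UNIV:
  fixes h :: "real \<Rightarrow> 'a::euclidean_space"
  assumes "continuous_on UNIV h"
  shows "\<exists>P. P 0 = 0 \<and> (\<forall>t. (P has_vector_derivative h t) (at t))"
proof -
  have "isCont h x" for x
    using assms by (simp add: continuous_on_eq_continuous_at)
  then obtain Q where Q: "\<And>t. (Q has_vector_derivative h t) (at t)"
    using einterval_antiderivative[of "-\<infinity>" "\<infinity>" h] by auto
  have "((\<lambda>t. Q t - Q 0) has_vector_derivative h t) (at t)" for t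
    using has_vector_derivative_diff[OF Q[of t] has_vector_derivative_const] by simp
  then show ?thesis
    by (intro exI[of _ "\<lambda>t. Q t - Q 0"]) simp
qed

text \<open>This is what makes the exponential weight \<open>exp (c * \<bar>t\<bar>)\<close> useful: integrating a function of that growth
gains a factor \<open>1 / c\<close>, so a large \<open>c\<close> turns the Picard operator into a contraction.\<close>

lemma norm_le_exp_if_deriv_le_exp_pos:
  fixes P :: "real \<Rightarrow> 'a::real_normed_vector"
  assumes P: "\<And>t. (P has_vector_derivative h t) (at t)" and "P 0 = 0"
    and h: "\<And>t. norm (h t) \<le> M * exp (c * \<bar>t\<bar>)" and "c > 0" and "t \<ge> 0"
  shows "norm (P t) \<le> M / c * exp (c * t)"
proof -
  have M: "M \<ge> 0"
    using order_trans[OF norm_ge_zero h[of 0]] by simp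
  show ?thesis
  proof (cases "t = 0")
    case False
    then have "0 < t" using assms by simp
    have dE: "((\<lambda>t. M / c * exp (c * t)) has_vector_derivative M * exp (c * s)) (at s)" for s
      unfolding has_real_derivative_iff_has_vector_derivative[symmetric]
      using \<open>c > 0\<close> by (auto intro!: derivative_eq_intros)
    have "norm (P t - P 0) \<le> M / c * exp (c * t) - M / c * exp (c * 0)"
    proof (rule differentiable_bound_general[OF \<open>0 < t\<close>])
      show "continuous_on {0..t} P"
        using P by (meson continuous_at_imp_continuous_on has_vector_derivative_continuous)
      show "continuous_on {0..t} (\<lambda>t. M / c * exp (c * t))"
        using \<open>c > 0\<close> by (intro continuous_intros) auto
      show "norm (h s) \<le> M * exp (c * s)" if "0 < s" "s < t" for s
        using h[of s] that by simp
    qed (use P dE in auto)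
    then show ?thesis using \<open>P 0 = 0\<close> M \<open>c > 0\<close>
      by (smt (verit) diff_zero divide_nonneg_nonneg exp_gt_zero mult_nonneg_nonneg)
  qed (use \<open>P 0 = 0\<close> M \<open>c > 0\<close> in auto)
qed

lemma has_vector_derivative_reflect:
  fixes P :: "real \<Rightarrow> 'a::real_normed_vector"
  assumes "\<And>t. (P has_vector_derivative h t) (at t)"
  shows "((\<lambda>t. P (- t)) has_vector_derivative - h (- t)) (at t)"
proof -
  have "(uminus has_vector_derivative - 1) (at t)"
    by (auto intro!: derivative_eq_intros)
  then show ?thesis
    using vector_diff_chain_at[of uminus "- 1::real" t P "h (- t)"] assms by (simp add: o_def)
qed

lemma norm_le_exp_if_deriv_le_exp:
  fixes P :: "real \<Rightarrow> 'a::real_normed_vector"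
  assumes P: "\<And>t. (P has_vector_derivative h t) (at t)" and "P 0 = 0"
    and h: "\<And>t. norm (h t) \<le> M * exp (c * \<bar>t\<bar>)" and "c > 0"
  shows "norm (P t) \<le> M / c * exp (c * \<bar>t\<bar>)"
proof (cases "t \<ge> 0")
  case True
  then show ?thesis
    using norm_le_exp_if_deriv_le_exp_pos[of P h M c t] assms by simp
next
  case False
  have "norm (P (- (- t))) \<le> M / c * exp (c * (- t))"
  proof (rule norm_le_exp_if_deriv_le_exp_pos)
    show "((\<lambda>t. P (- t)) has_vector_derivative - h (- s)) (at s)" for s
      by (rule has_vector_derivative_reflect[OF P])
    show "norm (- h (- s)) \<le> M * exp (c * \<bar>s\<bar>)" for s
      using h[of "- s"] by simp
  qed (use assms False in auto)
  with False show ?thesis by simp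
qed

text \<open>Write the unknown as \<open>w t = exp (c * \<bar>t\<bar>) *\<^sub>R y t\<close> with \<open>y\<close> bounded and continuous on the whole
line. In terms of \<open>y\<close> the integral equation is a fixed point problem for a map \<open>\<Psi>\<close> on the complete
space of bounded continuous functions, and by the preceding estimate \<open>\<Psi>\<close> has Lipschitz constant
\<open>\<bar>K\<bar> / c\<close>. Since \<open>K\<close> bounds the Lipschitz constant at all times, one application of Banach's
theorem gives a global solution, without continuation of local ones.\<close>

theorem lipschitz_ode_global_solution:
  fixes F :: "real \<Rightarrow> 'a::euclidean_space \<Rightarrow> 'a"
  assumes cont: "continuous_on UNIV (\<lambda>p. F (fst p) (snd p))"
    and lip: "\<And>t x y. norm (F t x - F t y) \<le> K * norm (x - y)"
    and bnd: "\<And>t. norm (F t 0) \<le> G"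
  shows "\<exists>w. w 0 = x0 \<and> (\<forall>t. (w has_vector_derivative F t (w t)) (at t))"
proof -
  \<comment> \<open>large enough for the contraction factor \<open>\<bar>K\<bar> / c\<close> to be at most one half\<close>
  define c where "c = 2 * \<bar>K\<bar> + 1"
  have c: "c > 0" "\<bar>K\<bar> / c \<le> 1/2" by (auto simp: c_def field_simps)
  have lip': "norm (F t x - F t y) \<le> \<bar>K\<bar> * norm (x - y)" for t x y
    using lip[of t x y] by (meson abs_ge_self mult_right_mono norm_ge_zero order_trans)
  define e where "e t = exp (c * \<bar>t\<bar>)" for t
  have e: "e t > 0" "e t \<ge> 1" "continuous_on X e" for t X
    using c unfolding e_def by (auto intro!: continuous_intros)
  define H where "H y s = F s (e s *\<^sub>R y s)" for y s
  have contH: "continuous_on UNIV (H y)" if "continuous_on UNIV y" for y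
  proof -
    have "continuous_on UNIV (\<lambda>s. (s, e s *\<^sub>R y s))"
      by (intro continuous_intros that e)
    from continuous_on_compose2[OF cont this] show ?thesis
      by (simp add: H_def[abs_def])
  qed
  \<comment> \<open>\<open>A h\<close> is the antiderivative of \<open>h\<close> that vanishes at \<open>0\<close>\<close>
  define A where "A h = (SOME P. P 0 = 0 \<and> (\<forall>t. (P has_vector_derivative h t) (at t)))"
    for h :: "real \<Rightarrow> 'a"
  have A: "A h 0 = 0" "(A h has_vector_derivative h t) (at t)" if "continuous_on UNIV h" for h t
    using someI_ex[OF antiderivative_UNIV[OF that]] unfolding A_def by auto
  define \<Phi> where "\<Phi> y t = (1 / e t) *\<^sub>R (x0 + A (H y) t)" for y t
  have A_cont: "continuous_on UNIV (A (H y))" if "continuous_on UNIV y" for y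
    using A(2)[OF contH[OF that]]
    by (meson continuous_at_imp_continuous_on has_vector_derivative_continuous)
  have \<Phi>_bcontfun: "\<Phi> y \<in> bcontfun" if y: "y \<in> bcontfun" for y
  proof -
    have ycont: "continuous_on UNIV y" and "bounded (range y)"
      using y by (auto simp: bcontfun_def)
    then obtain B where B: "\<And>t. norm (y t) \<le> B" by (auto simp: bounded_iff)
    have "norm (H y t) \<le> (G + \<bar>K\<bar> * B) * exp (c * \<bar>t\<bar>)" for t
    proof -
      have "norm (H y t) \<le> norm (F t 0) + norm (F t (e t *\<^sub>R y t) - F t 0)"
        unfolding H_def by norm
      also have "\<dots> \<le> G + \<bar>K\<bar> * norm (e t *\<^sub>R y t)"
        using bnd[of t] lip'[of t "e t *\<^sub>R y t" 0] by simp
      also have "\<dots> \<le> G * e t + \<bar>K\<bar> * (e t * B)"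
      proof (intro add_mono mult_left_mono)
        show "G \<le> G * e t"
          using mult_left_mono[OF e(2)[of t], of G] order_trans[OF norm_ge_zero bnd] by simp
        show "norm (e t *\<^sub>R y t) \<le> e t * B"
          using B[of t] e(1)[of t] by simp
      qed auto
      finally show ?thesis by (simp add: e_def algebra_simps)
    qed
    from norm_le_exp_if_deriv_le_exp[OF A(2)[OF contH[OF ycont]] A(1)[OF contH[OF ycont]] this c(1)]
    have AB: "norm (A (H y) t) \<le> (G + \<bar>K\<bar> * B) / c * e t" for t
      by (simp add: e_def)
    have "norm (\<Phi> y t) \<le> norm x0 + (G + \<bar>K\<bar> * B) / c" for t
    proof -
      have "norm (\<Phi> y t) \<le> (1 / e t) * (norm x0 + (G + \<bar>K\<bar> * B) / c * e t)"
        unfolding \<Phi>_def using e(1)[of t] AB[of t] norm_triangle_ineq[of x0 "A (H y) t"]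
        by (simp add: divide_right_mono)
      also have "\<dots> = norm x0 / e t + (G + \<bar>K\<bar> * B) / c"
        using e(1)[of t] by (simp add: field_simps)
      also have "\<dots> \<le> norm x0 + (G + \<bar>K\<bar> * B) / c"
        using e(2)[of t] by (simp add: divide_le_eq mult_left_mono)
          (metis mult.right_neutral mult_left_mono norm_ge_zero)
      finally show ?thesis .
    qed
    moreover have "continuous_on UNIV (\<Phi> y)"
      unfolding \<Phi>_def using e A_cont[OF ycont]
      by (intro continuous_intros) (auto simp: less_imp_neq[symmetric])
    ultimately show ?thesis by (intro bcontfun_normI)
  qed
  define \<Psi> where "\<Psi> y = Bcontfun (\<Phi> (apply_bcontfun y))" for y :: "real \<Rightarrow>\<^sub>C 'a"
  have \<Psi>: "apply_bcontfun (\<Psi> y) = \<Phi> (apply_bcontfun y)" for y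
    unfolding \<Psi>_def by (intro Bcontfun_inverse \<Phi>_bcontfun apply_bcontfun)
  have "dist (\<Psi> y) (\<Psi> z) \<le> (1/2) * dist y z" for y z
  proof (rule dist_bound)
    fix t
    let ?y = "apply_bcontfun y" and ?z = "apply_bcontfun z"
    let ?P = "\<lambda>t. A (H ?y) t - A (H ?z) t"
    have yc: "continuous_on UNIV (H ?y)" "continuous_on UNIV (H ?z)" by (auto intro: contH)
    have "norm (H ?y s - H ?z s) \<le> (\<bar>K\<bar> * dist y z) * exp (c * \<bar>s\<bar>)" for s
    proof -
      have "norm (H ?y s - H ?z s) \<le> \<bar>K\<bar> * (e s * dist (?y s) (?z s))"
        unfolding H_def using lip'[of s "e s *\<^sub>R ?y s" "e s *\<^sub>R ?z s"] e(1)[of s]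
        by (simp add: dist_norm flip: scaleR_diff_right)
      also have "\<dots> \<le> \<bar>K\<bar> * (e s * dist y z)"
        using e(1)[of s] by (intro mult_left_mono dist_bounded) auto
      finally show ?thesis by (simp add: e_def algebra_simps)
    qed
    from norm_le_exp_if_deriv_le_exp[OF has_vector_derivative_diff[OF A(2)[OF yc(1)] A(2)[OF yc(2)]]
      _ this c(1)]
    have "norm (?P t) \<le> \<bar>K\<bar> / c * dist y z * e t"
      using A(1)[OF yc(1)] A(1)[OF yc(2)] by (simp add: e_def)
    also have "\<dots> \<le> 1/2 * dist y z * e t"
      using c(2) e(1)[of t] by (intro mult_right_mono) auto
    finally have "norm (?P t) / e t \<le> 1/2 * dist y z"
      using e(1)[of t] by (simp add: divide_le_eq)
    moreover have "dist (\<Psi> y t) (\<Psi> z t) = norm (?P t) / e t"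
      unfolding \<Psi> \<Phi>_def dist_norm using e(1)[of t]
      by (simp flip: scaleR_diff_right)
    ultimately show "dist (\<Psi> y t) (\<Psi> z t) \<le> 1/2 * dist y z" by simp
  qed
  then obtain y where y: "\<Psi> y = y"
    using banach_fix_type[of "1/2" \<Psi>] by auto
  define w where "w t = e t *\<^sub>R apply_bcontfun y t" for t
  have Hc: "continuous_on UNIV (H (apply_bcontfun y))" by (auto intro: contH)
  have w: "w t = x0 + A (H (apply_bcontfun y)) t" for t
    using arg_cong[OF y, of "\<lambda>y. apply_bcontfun y t"] e(1)[of t] unfolding w_def \<Psi> \<Phi>_def
    by (metis (no_types, lifting) divide_self less_numeral_extra(3) mult.commute
        scaleR_one scaleR_scaleR times_divide_eq_left mult_1)
  have "(w has_vector_derivative F t (w t)) (at t)" for t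
  proof -
    have "((\<lambda>t. x0 + A (H (apply_bcontfun y)) t) has_vector_derivative 0 + H (apply_bcontfun y) t) (at t)"
      by (intro has_vector_derivative_add has_vector_derivative_const A(2)[OF Hc])
    moreover have "H (apply_bcontfun y) t = F t (w t)"
      by (simp add: H_def w_def)
    moreover have "w = (\<lambda>t. x0 + A (H (apply_bcontfun y)) t)"
      using w by (rule ext)
    ultimately show ?thesis by simp
  qed
  moreover have "w 0 = x0" using w[of 0] A(1)[OF Hc] by simp
  ultimately show ?thesis by blast
qed

text \<open>The function \<open>exp (- 2 * K * s) * (d s \<bullet> d s)\<close> has nonpositive derivative and vanishes at \<open>0\<close>.\<close>

lemma gronwall_zero_pos:
  fixes d :: "real \<Rightarrow> 'a::real_inner"
  assumes d: "\<And>t. (d has_vector_derivative d' t) (at t)" and "d 0 = 0"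
    and le: "\<And>t. norm (d' t) \<le> K * norm (d t)" and "t \<ge> 0"
  shows "d t = 0"
proof -
  let ?g = "\<lambda>s. exp (- 2 * K * s) * (d s \<bullet> d s)"
  have "?g t \<le> ?g 0"
  proof (rule DERIV_nonpos_imp_nonincreasing[OF \<open>t \<ge> 0\<close>])
    fix s
    have "((\<lambda>s. d s \<bullet> d s) has_real_derivative 2 * (d s \<bullet> d' s)) (at s)"
      using bounded_bilinear.has_vector_derivative[OF bounded_bilinear_inner d[of s] d[of s]]
      by (simp add: has_real_derivative_iff_has_vector_derivative inner_commute)
    then have "(?g has_real_derivative
        exp (- 2 * K * s) * (2 * (d s \<bullet> d' s)) + - 2 * K * exp (- 2 * K * s) * (d s \<bullet> d s)) (at s)"
      by (auto intro!: derivative_eq_intros)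
    moreover have "d s \<bullet> d' s \<le> K * (d s \<bullet> d s)"
    proof -
      have "d s \<bullet> d' s \<le> norm (d s) * norm (d' s)" by (rule norm_cauchy_schwarz)
      also have "\<dots> \<le> norm (d s) * (K * norm (d s))" by (intro mult_left_mono le) simp
      finally show ?thesis by (simp add: dot_square_norm power2_eq_square algebra_simps)
    qed
    then have "exp (- 2 * K * s) * (2 * (d s \<bullet> d' s) - 2 * K * (d s \<bullet> d s)) \<le> 0"
      by (intro mult_nonneg_nonpos) auto
    ultimately show "\<exists>y. (?g has_real_derivative y) (at s) \<and> y \<le> 0"
      by (intro exI conjI) (auto simp: algebra_simps)
  qed
  then have "d t \<bullet> d t \<le> 0" using \<open>d 0 = 0\<close> by (simp add: mult_le_0_iff)
  then show ?thesis by (metis inner_eq_zero_iff inner_ge_zero order_antisym)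
qed

lemma gronwall_zero:
  fixes d :: "real \<Rightarrow> 'a::real_inner"
  assumes d: "\<And>t. (d has_vector_derivative d' t) (at t)" and "d 0 = 0"
    and le: "\<And>t. norm (d' t) \<le> K * norm (d t)"
  shows "d t = 0"
proof (cases "t \<ge> 0")
  case True
  then show ?thesis using gronwall_zero_pos[of d d' K t] assms by blast
next
  case False
  have "d (- (- t)) = 0"
    by (rule gronwall_zero_pos[of "\<lambda>t. d (- t)", OF has_vector_derivative_reflect[OF d]])
      (use assms False in auto)
  then show ?thesis by simp
qed

lemma lipschitz_ode_unique:
  fixes F :: "real \<Rightarrow> 'a::real_inner \<Rightarrow> 'a"
  assumes lip: "\<And>t x y. norm (F t x - F t y) \<le> K * norm (x - y)"
    and v: "\<And>t. (v has_vector_derivative F t (v t)) (at t)"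
    and w: "\<And>t. (w has_vector_derivative F t (w t)) (at t)"
    and "v 0 = w 0"
  shows "v = w"
proof
  fix t
  have "v t - w t = 0"
    by (rule gronwall_zero[of "\<lambda>t. v t - w t", OF has_vector_derivative_diff[OF v w]])
      (use assms in auto)
  then show "v t = w t" by simp
qed

section \<open>Smooth functions of one real variable\<close>

text \<open>The derivative as an operator on functions, so that it can be iterated with \<open>^^\<close>.\<close>

definition ddz :: "(real \<Rightarrow> 'a::real_normed_vector) \<Rightarrow> real \<Rightarrow> 'a"
  where "ddz f = (\<lambda>z. vector_derivative f (at z))"

lemma ddz_eqI: "(\<And>t. (f has_vector_derivative f' t) (at t)) \<Longrightarrow> ddz f = f'"
  unfolding ddz_def by (auto intro: vector_derivative_at)

lemma C_n_on_bounded_linear: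
  fixes f :: "'a::real_normed_vector \<Rightarrow> 'b::real_normed_vector"
    and T :: "'b \<Rightarrow> 'c::real_normed_vector"
  assumes T: "bounded_linear T"
  shows "C_n_on n UNIV f \<Longrightarrow> C_n_on n UNIV (\<lambda>x. T (f x))"
proof (induction n arbitrary: f)
  case 0
  then show ?case using T by (auto intro: linear_continuous_on_compose bounded_linear.continuous_on)
next
  case (Suc n)
  have "((\<lambda>x. T (f x)) has_derivative (\<lambda>h. T (frechet_derivative f (at x) h))) (at x)" for x
    using Suc.prems by (auto intro!: bounded_linear.has_derivative[OF T]
        simp flip: frechet_derivative_works)
  then have "(\<lambda>x. T (f x)) differentiable (at x)"
    "frechet_derivative (\<lambda>x. T (f x)) (at x) = (\<lambda>h. T (frechet_derivative f (at x) h))" for x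
    by (auto simp: differentiable_def frechet_derivative_at[symmetric])
  then show ?case using Suc by simp
qed

text \<open>On the real line the directional derivatives in \<open>C_n_on\<close> are all multiples of the ordinary
derivative. This recursion is the form in which smoothness is used below for functions of one
variable.\<close>

lemma C_n_on_Suc_real:
  fixes f :: "real \<Rightarrow> 'b::real_normed_vector"
  shows "C_n_on (Suc n) UNIV f \<longleftrightarrow>
    (\<exists>f'. (\<forall>t. (f has_vector_derivative f' t) (at t)) \<and> C_n_on n UNIV f')"
proof
  assume *: "C_n_on (Suc n) UNIV f"
  have "(f has_vector_derivative frechet_derivative f (at t) 1) (at t)" for t
  proof -
    have "(f has_derivative frechet_derivative f (at t)) (at t)"
      using * by (simp flip: frechet_derivative_works)
    moreover from this have "frechet_derivative f (at t) = (\<lambda>h. h *\<^sub>R frechet_derivative f (at t) 1)"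
      by (metis has_derivative_linear linear_cmul mult.right_neutral real_scaleR_def)
    ultimately show ?thesis unfolding has_vector_derivative_def by simp
  qed
  then show "\<exists>f'. (\<forall>t. (f has_vector_derivative f' t) (at t)) \<and> C_n_on n UNIV f'"
    using * by (intro exI[of _ "\<lambda>t. frechet_derivative f (at t) 1"]) simp
next
  assume "\<exists>f'. (\<forall>t. (f has_vector_derivative f' t) (at t)) \<and> C_n_on n UNIV f'"
  then obtain f' where f': "\<And>t. (f has_vector_derivative f' t) (at t)" "C_n_on n UNIV f'"
    by blast
  have "frechet_derivative f (at t) = (\<lambda>h. h *\<^sub>R f' t)" for t
    using f'(1)[of t] unfolding has_vector_derivative_def by (simp add: frechet_derivative_at[symmetric])
  then show "C_n_on (Suc n) UNIV f"
    using f' C_n_on_bounded_linear[OF bounded_linear_scaleR_right f'(2)]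
    by (auto simp: differentiable_def has_vector_derivative_def)
qed

declare C_n_on.simps(2) [simp del]

lemma C_n_on_SucD:
  fixes f :: "real \<Rightarrow> 'b::real_normed_vector"
  shows "C_n_on (Suc n) UNIV f \<Longrightarrow> C_n_on n UNIV f"
proof (induction n arbitrary: f)
  case 0
  then show ?case
    unfolding C_n_on_Suc_real C_n_on.simps(1) continuous_on_eq_continuous_within
    by (blast intro: has_vector_derivative_continuous)
next
  case (Suc n)
  then show ?case by (meson C_n_on_Suc_real)
qed

lemma C_n_on_add:
  fixes f g :: "real \<Rightarrow> 'b::real_normed_vector"
  shows "C_n_on n UNIV f \<Longrightarrow> C_n_on n UNIV g \<Longrightarrow> C_n_on n UNIV (\<lambda>x. f x + g x)"
proof (induction n arbitrary: f g)
  case 0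
  then show ?case by (auto intro: continuous_intros)
next
  case (Suc n)
  obtain f' g' where "\<And>t. (f has_vector_derivative f' t) (at t)" "C_n_on n UNIV f'"
    "\<And>t. (g has_vector_derivative g' t) (at t)" "C_n_on n UNIV g'"
    using Suc.prems unfolding C_n_on_Suc_real by blast
  with Suc.IH show ?case
    unfolding C_n_on_Suc_real
    by (intro exI[of _ "\<lambda>x. f' x + g' x"] conjI allI has_vector_derivative_add)
qed

lemma C_n_on_scaleR:
  fixes f :: "real \<Rightarrow> real" and g :: "real \<Rightarrow> 'b::real_normed_vector"
  shows "C_n_on n UNIV f \<Longrightarrow> C_n_on n UNIV g \<Longrightarrow> C_n_on n UNIV (\<lambda>x. f x *\<^sub>R g x)"
proof (induction n arbitrary: f g)
  case 0
  then show ?case by (auto intro: continuous_intros)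
next
  case (Suc n)
  obtain f' g' where *: "\<And>t. (f has_vector_derivative f' t) (at t)" "C_n_on n UNIV f'"
    "\<And>t. (g has_vector_derivative g' t) (at t)" "C_n_on n UNIV g'"
    using Suc.prems unfolding C_n_on_Suc_real by blast
  have "C_n_on n UNIV (\<lambda>x. f x *\<^sub>R g' x + f' x *\<^sub>R g x)"
    using Suc.IH * Suc.prems[THEN C_n_on_SucD] by (intro C_n_on_add)
  with * show ?case
    unfolding C_n_on_Suc_real
    by (intro exI[of _ "\<lambda>x. f x *\<^sub>R g' x + f' x *\<^sub>R g x"] conjI allI
        bounded_bilinear.has_vector_derivative[OF bounded_bilinear_scaleR])
qed

lemma C_n_on_compose:
  fixes f :: "real \<Rightarrow> real" and g :: "real \<Rightarrow> 'b::real_normed_vector"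
  shows "C_n_on n UNIV f \<Longrightarrow> C_n_on n UNIV g \<Longrightarrow> C_n_on n UNIV (\<lambda>x. g (f x))"
proof (induction n arbitrary: g)
  case 0
  then show ?case by (auto intro: continuous_on_compose2[of UNIV g])
next
  case (Suc n)
  obtain f' g' where *: "\<And>t. (f has_vector_derivative f' t) (at t)" "C_n_on n UNIV f'"
    "\<And>t. (g has_vector_derivative g' t) (at t)" "C_n_on n UNIV g'"
    using Suc.prems unfolding C_n_on_Suc_real by blast
  have "C_n_on n UNIV (\<lambda>x. f' x *\<^sub>R g' (f x))"
    using Suc.IH * Suc.prems(1)[THEN C_n_on_SucD] by (intro C_n_on_scaleR)
  moreover have "\<forall>t. ((\<lambda>x. g (f x)) has_vector_derivative f' t *\<^sub>R g' (f t)) (at t)"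
    using vector_diff_chain_at[OF *(1) *(3)] by (simp add: o_def)
  ultimately show ?case
    unfolding C_n_on_Suc_real by (intro exI[of _ "\<lambda>x. f' x *\<^sub>R g' (f x)"] conjI)
qed

lemma smooth_real_ddz:
  fixes f :: "real \<Rightarrow> 'b::real_normed_vector"
  assumes "smooth_on UNIV f"
  shows "(f has_vector_derivative ddz f t) (at t)" and "smooth_on UNIV (ddz f)"
proof -
  have *: "(\<forall>t. (f has_vector_derivative ddz f t) (at t)) \<and> C_n_on n UNIV (ddz f)" for n
  proof -
    have "C_n_on (Suc n) UNIV f" using assms unfolding smooth_on_def by (rule spec)
    then obtain f' where f': "\<And>t. (f has_vector_derivative f' t) (at t)" "C_n_on n UNIV f'"
      unfolding C_n_on_Suc_real by blast
    with ddz_eqI[OF f'(1)] show ?thesis by simp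
  qed
  then show "smooth_on UNIV (ddz f)" by (simp add: smooth_on_def)
  show "(f has_vector_derivative ddz f t) (at t)"
    using *[of 0] by simp
qed

lemma smooth_real_continuous:
  fixes f :: "real \<Rightarrow> 'b::real_normed_vector"
  assumes "smooth_on UNIV f"
  shows "continuous_on X f"
proof -
  have "C_n_on 0 UNIV f" using assms unfolding smooth_on_def by (rule spec)
  then show ?thesis using continuous_on_subset[of UNIV f X] by simp
qed

lemma smooth_real_add:
  fixes f g :: "real \<Rightarrow> 'b::real_normed_vector"
  shows "smooth_on UNIV f \<Longrightarrow> smooth_on UNIV g \<Longrightarrow> smooth_on UNIV (\<lambda>x. f x + g x)"
  by (simp add: smooth_on_def C_n_on_add)

lemma smooth_bounded_linear:
  fixes f :: "real \<Rightarrow> 'b::real_normed_vector"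
  shows "bounded_linear T \<Longrightarrow> smooth_on UNIV f \<Longrightarrow> smooth_on UNIV (\<lambda>x. T (f x))"
  by (simp add: smooth_on_def C_n_on_bounded_linear)

lemma smooth_real_scaleR:
  fixes f :: "real \<Rightarrow> real" and g :: "real \<Rightarrow> 'b::real_normed_vector"
  shows "smooth_on UNIV f \<Longrightarrow> smooth_on UNIV g \<Longrightarrow> smooth_on UNIV (\<lambda>x. f x *\<^sub>R g x)"
  by (simp add: smooth_on_def C_n_on_scaleR)

lemma smooth_real_compose:
  fixes f :: "real \<Rightarrow> real" and g :: "real \<Rightarrow> 'b::real_normed_vector"
  shows "smooth_on UNIV f \<Longrightarrow> smooth_on UNIV g \<Longrightarrow> smooth_on UNIV (\<lambda>x. g (f x))"
  by (simp add: smooth_on_def C_n_on_compose)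

lemma ddz_add:
  fixes f g :: "real \<Rightarrow> 'b::real_normed_vector"
  assumes "smooth_on UNIV f" "smooth_on UNIV g"
  shows "ddz (\<lambda>x. f x + g x) = (\<lambda>x. ddz f x + ddz g x)"
  by (intro ddz_eqI has_vector_derivative_add smooth_real_ddz assms)

lemma ddz_bounded_linear:
  fixes f :: "real \<Rightarrow> 'b::real_normed_vector"
  assumes "bounded_linear T" "smooth_on UNIV f"
  shows "ddz (\<lambda>x. T (f x)) = (\<lambda>x. T (ddz f x))"
  by (rule ddz_eqI)
    (rule bounded_linear.has_vector_derivative[OF assms(1) smooth_real_ddz(1)[OF assms(2)]])

lemma smooth_real_deriv:
  assumes "smooth_on UNIV (V :: real \<Rightarrow> real)"
  shows "smooth_on UNIV (deriv V)" and "(V has_real_derivative deriv V x) (at x)"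
proof -
  have d: "(V has_real_derivative ddz V x) (at x)" for x
    using smooth_real_ddz(1)[OF assms] by (simp add: has_real_derivative_iff_has_vector_derivative)
  then have "deriv V = ddz V" by (auto intro: DERIV_imp_deriv)
  then show "smooth_on UNIV (deriv V)" "(V has_real_derivative deriv V x) (at x)"
    using smooth_real_ddz(2)[OF assms] d by simp_all
qed

section \<open>Smooth families of functions of one variable\<close>

text \<open>For a family \<open>f (z, \<kappa>)\<close>, \<open>partial1\<close> is the derivative in \<open>z\<close> and \<open>partial2\<close> the derivative in the
parameter \<open>\<kappa>\<close>. Total functions on pairs make both iterable; their values matter only where the
family is smooth.\<close>

definition partial1 :: "(real \<times> real \<Rightarrow> real) \<Rightarrow> real \<times> real \<Rightarrow> real"
  where "partial1 f p = frechet_derivative f (at p) (1, 0)"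

definition partial2 :: "(real \<times> real \<Rightarrow> real) \<Rightarrow> real \<times> real \<Rightarrow> real"
  where "partial2 f p = frechet_derivative f (at p) (0, 1)"

lemma smooth_on_frechet:
  assumes "smooth_on S f"
  shows "smooth_on S (\<lambda>x. frechet_derivative f (at x) v)"
    and "x \<in> S \<Longrightarrow> (f has_derivative frechet_derivative f (at x)) (at x)"
    and "continuous_on S f"
proof -
  have *: "C_n_on n S f" for n using assms by (simp add: smooth_on_def)
  show "smooth_on S (\<lambda>x. frechet_derivative f (at x) v)"
    unfolding smooth_on_def using *[of "Suc _"] by (simp add: C_n_on.simps(2))
  show "x \<in> S \<Longrightarrow> (f has_derivative frechet_derivative f (at x)) (at x)"
    using *[of "Suc 0"] by (simp add: C_n_on.simps(2) flip: frechet_derivative_works)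
  show "continuous_on S f" using *[of 0] by simp
qed

lemma smooth_on_partial:
  assumes "smooth_on S f"
  shows "smooth_on S (partial1 f)" "smooth_on S (partial2 f)"
  using smooth_on_frechet(1)[OF assms] by (simp_all add: partial1_def[abs_def] partial2_def[abs_def])

lemma smooth_on_partial1_iter: "smooth_on S f \<Longrightarrow> smooth_on S ((partial1 ^^ i) f)"
  by (induction i) (auto intro: smooth_on_partial)

lemma partial1_has_derivative:
  assumes "smooth_on S f" "(z, \<kappa>) \<in> S"
  shows "((\<lambda>z. f (z, \<kappa>)) has_real_derivative partial1 f (z, \<kappa>)) (at z)"
proof -
  have f: "(f has_derivative frechet_derivative f (at (z, \<kappa>))) (at (z, \<kappa>))"
    using smooth_on_frechet(2)[OF assms] .
  have "((\<lambda>z. f (z, \<kappa>)) has_derivative (\<lambda>h. frechet_derivative f (at (z, \<kappa>)) (h, 0))) (at z)"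
    by (rule has_derivative_compose[where f="\<lambda>z. (z, \<kappa>)", OF _ f]) (auto intro!: derivative_eq_intros)
  moreover have "frechet_derivative f (at (z, \<kappa>)) (h, 0) = partial1 f (z, \<kappa>) * h" for h
    using linear_cmul[OF has_derivative_linear[OF f], of h "(1, 0)"] by (simp add: partial1_def)
  ultimately show ?thesis by (simp add: has_field_derivative_def)
qed

lemma partial2_has_derivative:
  assumes "smooth_on S f" "(z, \<kappa>) \<in> S"
  shows "((\<lambda>\<kappa>. f (z, \<kappa>)) has_real_derivative partial2 f (z, \<kappa>)) (at \<kappa>)"
proof -
  have f: "(f has_derivative frechet_derivative f (at (z, \<kappa>))) (at (z, \<kappa>))"
    using smooth_on_frechet(2)[OF assms] .
  have "((\<lambda>\<kappa>. f (z, \<kappa>)) has_derivative (\<lambda>h. frechet_derivative f (at (z, \<kappa>)) (0, h))) (at \<kappa>)"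
    by (rule has_derivative_compose[where f="\<lambda>\<kappa>. (z, \<kappa>)", OF _ f]) (auto intro!: derivative_eq_intros)
  moreover have "frechet_derivative f (at (z, \<kappa>)) (0, h) = partial2 f (z, \<kappa>) * h" for h
    using linear_cmul[OF has_derivative_linear[OF f], of h "(0, 1)"] by (simp add: partial2_def)
  ultimately show ?thesis by (simp add: has_field_derivative_def)
qed

lemma smooth_section:
  fixes f :: "real \<times> real \<Rightarrow> real"
  assumes "smooth_on (UNIV \<times> I) f" "\<kappa> \<in> I"
  shows "smooth_on UNIV (\<lambda>z. f (z, \<kappa>))"
proof -
  have "C_n_on n UNIV (\<lambda>z. f (z, \<kappa>))" for n
    using assms(1)
  proof (induction n arbitrary: f)
    case 0
    have "continuous_on UNIV (\<lambda>z. (z, \<kappa>))" by (intro continuous_intros)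
    from continuous_on_compose2[OF smooth_on_frechet(3)[OF 0] this] show ?case
      using \<open>\<kappa> \<in> I\<close> by auto
  next
    case (Suc n)
    then show ?case
      using partial1_has_derivative[OF Suc.prems(1)] smooth_on_partial(1)[OF Suc.prems(1)] \<open>\<kappa> \<in> I\<close>
      by (auto simp: C_n_on_Suc_real has_real_derivative_iff_has_vector_derivative
          intro!: exI[of _ "\<lambda>z. partial1 f (z, \<kappa>)"])
  qed
  then show ?thesis by (simp add: smooth_on_def)
qed

lemma integral_param_has_derivative:
  fixes f f' :: "real \<times> real \<Rightarrow> real"
  assumes f': "\<And>z x. x \<in> I \<Longrightarrow> ((\<lambda>x. f (z, x)) has_real_derivative f' (z, x)) (at x)"
    and cont: "continuous_on (UNIV \<times> I) f" "continuous_on (UNIV \<times> I) f'"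
    and I: "open I" "is_interval I" "\<kappa> \<in> I"
  shows "((\<lambda>x. integral {a..b} (\<lambda>z. f (z, x))) has_real_derivative
    integral {a..b} (\<lambda>z. f' (z, \<kappa>))) (at \<kappa>)"
proof -
  have "((\<lambda>x. integral (cbox a b) (\<lambda>z. f (z, x))) has_real_derivative
    integral (cbox a b) (\<lambda>z. f' (z, \<kappa>))) (at \<kappa> within I)"
  proof (rule leibniz_rule_field_derivative)
    show "((\<lambda>x. f (z, x)) has_real_derivative f' (z, x)) (at x within I)" if "x \<in> I" for x z
      using f'[OF that] by (rule has_field_derivative_at_within)
    show "(\<lambda>z. f (z, x)) integrable_on cbox a b" if "x \<in> I" for x
      by (intro integrable_continuous continuous_on_compose2[OF cont(1)] continuous_intros)
        (use that in auto)
    have "continuous_on (I \<times> cbox a b) (\<lambda>p. (snd p, fst p))" by (intro continuous_intros)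
    moreover have "(\<lambda>p. (snd p, fst p)) ` (I \<times> cbox a b) \<subseteq> UNIV \<times> I" by auto
    ultimately show "continuous_on (I \<times> cbox a b) (\<lambda>(x, t). f' (t, x))"
      using continuous_on_compose2[OF cont(2)] by (simp add: split_beta)
    show "convex I" using I by (simp add: is_interval_convex)
  qed fact
  then show ?thesis using I by (simp add: at_within_open[of \<kappa> I])
qed

text \<open>Schwarz's theorem. Write \<open>f (y, x) = f (z - 1, x) + integral {z - 1..y} (\<lambda>s. partial1 f (s, x))\<close>,
differentiate in \<open>x\<close> under the integral sign, and then differentiate in \<open>y\<close> by the fundamental
theorem of calculus. The base point \<open>z - 1\<close> puts \<open>z\<close> in the interior of the domain of \<open>y\<close>.\<close>

lemma partial_commute:
  assumes f: "smooth_on (UNIV \<times> I) f" and I: "open I" "is_interval I" "\<kappa> \<in> I"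
  shows "partial2 (partial1 f) (z, \<kappa>) = partial1 (partial2 f) (z, \<kappa>)"
proof -
  let ?a = "z - 1" and ?b = "z + 1"
  note f1 = smooth_on_partial(1)[OF f] and f2 = smooth_on_partial(2)[OF f]
  have eq: "f (y, x) = f (?a, x) + integral {?a..y} (\<lambda>s. partial1 f (s, x))" if "x \<in> I" "y \<ge> ?a" for x y
  proof -
    have "((\<lambda>s. partial1 f (s, x)) has_integral f (y, x) - f (?a, x)) {?a..y}"
      using that partial1_has_derivative[OF f, of _ x]
      by (intro fundamental_theorem_of_calculus)
        (auto simp flip: has_real_derivative_iff_has_vector_derivative intro: has_field_derivative_at_within)
    then show ?thesis by (simp add: integral_unique)
  qed
  have eq2: "partial2 f (y, \<kappa>) = partial2 f (?a, \<kappa>) + integral {?a..y} (\<lambda>s. partial2 (partial1 f) (s, \<kappa>))"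
    if "y \<ge> ?a" for y
  proof -
    have "((\<lambda>x. f (?a, x) + integral {?a..y} (\<lambda>s. partial1 f (s, x))) has_real_derivative
       partial2 f (?a, \<kappa>) + integral {?a..y} (\<lambda>s. partial2 (partial1 f) (s, \<kappa>))) (at \<kappa>)"
      using I
      by (intro DERIV_add integral_param_has_derivative[of I]
          smooth_on_frechet(3)[OF f1] smooth_on_frechet(3)[OF smooth_on_partial(2)[OF f1]]
          partial2_has_derivative[OF f] partial2_has_derivative[OF f1]) auto
    then have "((\<lambda>x. f (y, x)) has_real_derivative
       partial2 f (?a, \<kappa>) + integral {?a..y} (\<lambda>s. partial2 (partial1 f) (s, \<kappa>))) (at \<kappa>)"
      by (rule has_field_derivative_transform_within_open[OF _ I(1,3)]) (simp add: eq[OF _ that])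
    then show ?thesis
      using partial2_has_derivative[OF f, of y \<kappa>] I DERIV_unique by blast
  qed
  have "continuous_on {?a..?b} (\<lambda>s. partial2 (partial1 f) (s, \<kappa>))"
    by (rule smooth_real_continuous[OF smooth_section[OF smooth_on_partial(2)[OF f1] I(3)]])
  then have "((\<lambda>y. integral {?a..y} (\<lambda>s. partial2 (partial1 f) (s, \<kappa>))) has_real_derivative
      partial2 (partial1 f) (z, \<kappa>)) (at z within {?a..?b})"
    by (rule integral_has_real_derivative) auto
  then have "((\<lambda>y. integral {?a..y} (\<lambda>s. partial2 (partial1 f) (s, \<kappa>))) has_real_derivative
      partial2 (partial1 f) (z, \<kappa>)) (at z)"
    by (simp add: at_within_Icc_at)
  then have "((\<lambda>y. partial2 f (?a, \<kappa>) + integral {?a..y} (\<lambda>s. partial2 (partial1 f) (s, \<kappa>)))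
      has_real_derivative 0 + partial2 (partial1 f) (z, \<kappa>)) (at z)"
    by (intro DERIV_add DERIV_const)
  then have "((\<lambda>y. partial2 f (y, \<kappa>)) has_real_derivative partial2 (partial1 f) (z, \<kappa>)) (at z)"
    unfolding add_0
    by (rule has_field_derivative_transform_within_open[where S="{?a<..}"]) (auto intro!: eq2[symmetric])
  then show ?thesis
    using partial1_has_derivative[OF f2, of z \<kappa>] I DERIV_unique by blast
qed

lemma partial1_cong:
  assumes "smooth_on (UNIV \<times> I) f" "smooth_on (UNIV \<times> I) g" "\<kappa> \<in> I"
    and "\<And>z. f (z, \<kappa>) = g (z, \<kappa>)"
  shows "partial1 f (z, \<kappa>) = partial1 g (z, \<kappa>)"
  using partial1_has_derivative[OF assms(1), of z \<kappa>] partial1_has_derivative[OF assms(2), of z \<kappa>]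
    assms(3,4) DERIV_unique by auto

text \<open>Used to identify the parameter derivative of the \<open>i\<close>-th \<open>z\<close>-derivative of the wave profile with
the \<open>i\<close>-th \<open>z\<close>-derivative of its parameter derivative.\<close>

lemma partial_commute_iter:
  assumes f: "smooth_on (UNIV \<times> I) f" and I: "open I" "is_interval I" "\<kappa> \<in> I"
  shows "partial2 ((partial1 ^^ i) f) (z, \<kappa>) = (partial1 ^^ i) (partial2 f) (z, \<kappa>)"
proof (induction i arbitrary: z)
  case (Suc i)
  note fi = smooth_on_partial1_iter[OF f, of i]
  have "partial2 (partial1 ((partial1 ^^ i) f)) (z, \<kappa>) = partial1 (partial2 ((partial1 ^^ i) f)) (z, \<kappa>)"
    by (rule partial_commute[OF fi I])
  also have "\<dots> = partial1 ((partial1 ^^ i) (partial2 f)) (z, \<kappa>)"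
    using Suc.IH I(3) f by (intro partial1_cong) (auto intro: smooth_on_partial smooth_on_partial1_iter)
  finally show ?case by simp
qed simp

lemma deriv_iter_section:
  assumes f: "smooth_on (UNIV \<times> I) f" and "\<kappa> \<in> I"
  shows "(deriv ^^ i) (\<lambda>z. f (z, \<kappa>)) = (\<lambda>z. (partial1 ^^ i) f (z, \<kappa>))"
proof (induction i)
  case (Suc i)
  then show ?case
    using partial1_has_derivative[OF smooth_on_partial1_iter[OF f, of i]] \<open>\<kappa> \<in> I\<close>
    by (auto intro!: DERIV_imp_deriv)
qed simp

section \<open>Smooth periodic functions and their pairing\<close>

lemma smooth_periodicD:
  assumes "smooth_periodic v"
  shows "smooth_on UNIV v" "v (z + 2 * pi) = v z"
  using assms by (auto simp: smooth_periodic_def)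

lemma smooth_periodic_add:
  "smooth_periodic f \<Longrightarrow> smooth_periodic g \<Longrightarrow> smooth_periodic (\<lambda>z. f z + g z)"
  by (simp add: smooth_periodic_def smooth_real_add)

lemma smooth_periodic_cmult:
  "smooth_periodic f \<Longrightarrow> smooth_periodic (\<lambda>z. c * f z)"
  using smooth_bounded_linear[OF bounded_linear_mult_right[of c], of f] by (simp add: smooth_periodic_def)

lemma smooth_periodic_of_real_mult:
  assumes "smooth_on UNIV q" "\<And>z. q (z + 2 * pi) = q z" "smooth_periodic f"
  shows "smooth_periodic (\<lambda>z. of_real (q z) * f z)"
  using smooth_real_scaleR[of q f] assms by (simp add: smooth_periodic_def scaleR_conv_of_real)

lemma smooth_periodic_ddz:
  assumes "smooth_periodic f"
  shows "smooth_periodic (ddz f)"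
proof -
  note f = smooth_periodicD[OF assms]
  have "ddz f (z + 2 * pi) = ddz f z" for z
  proof -
    have "((\<lambda>z. z + 2 * pi) has_vector_derivative 1) (at z)"
      by (auto intro!: derivative_eq_intros)
    from vector_diff_chain_at[OF this smooth_real_ddz(1)[OF f(1)]]
    have "(f has_vector_derivative ddz f (z + 2 * pi)) (at z)"
      by (simp add: o_def f(2))
    then show ?thesis by (simp add: ddz_def vector_derivative_at)
  qed
  then show ?thesis using smooth_real_ddz(2)[OF f(1)] by (simp add: smooth_periodic_def)
qed

lemma smooth_periodic_ddz_iter: "smooth_periodic f \<Longrightarrow> smooth_periodic ((ddz ^^ i) f)"
  by (induction i) (auto intro: smooth_periodic_ddz)

lemmas smooth_periodic_intros = smooth_periodic_add smooth_periodic_cmult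
  smooth_periodic_ddz smooth_periodic_ddz_iter

lemma ddz_iter_has_derivative:
  assumes "smooth_periodic f"
  shows "((ddz ^^ i) f has_vector_derivative (ddz ^^ Suc i) f t) (at t)"
  using smooth_real_ddz(1)[OF smooth_periodicD(1)[OF smooth_periodic_ddz_iter[OF assms]]] by simp

lemma ddz_iter_add:
  assumes "smooth_periodic f" "smooth_periodic g"
  shows "(ddz ^^ i) (\<lambda>z. f z + g z) = (\<lambda>z. (ddz ^^ i) f z + (ddz ^^ i) g z)"
  by (induction i)
    (use assms in \<open>auto intro!: ddz_add smooth_periodicD smooth_periodic_intros\<close>)

lemma ddz_iter_cmult:
  assumes "smooth_periodic f"
  shows "(ddz ^^ i) (\<lambda>z. c * f z) = (\<lambda>z. c * (ddz ^^ i) f z)"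
  by (induction i)
    (use assms in \<open>auto intro!: ddz_bounded_linear bounded_linear_mult_right smooth_periodicD smooth_periodic_intros\<close>)

lemma periodic_nat:
  assumes "\<And>z. f (z + p) = f z"
  shows "f (z + real n * p) = f z"
proof (induction n)
  case (Suc n)
  then show ?case using assms[of "z + real n * p"] by (simp add: algebra_simps)
qed simp

lemma periodic_int:
  fixes p :: real
  assumes "\<And>z. f (z + p) = f z"
  shows "f (z + of_int n * p) = f z"
proof (cases "n \<ge> 0")
  case True
  then show ?thesis using periodic_nat[of f p z "nat n", OF assms] by simp
next
  case False
  then show ?thesis using periodic_nat[of f p "z + of_int n * p" "nat (- n)", OF assms] by simp
qed

lemma periodic_continuous_bounded:
  fixes f :: "real \<Rightarrow> 'b::real_normed_vector"
  assumes "\<And>z. f (z + 2 * pi) = f z" "continuous_on UNIV f"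
  obtains B where "\<And>t. norm (f t) \<le> B"
proof -
  have "compact (f ` {0..2 * pi})"
    using assms(2) by (intro compact_continuous_image) (auto intro: continuous_on_subset)
  then obtain B where B: "\<And>t. t \<in> {0..2 * pi} \<Longrightarrow> norm (f t) \<le> B"
    using compact_imp_bounded[of "f ` {0..2 * pi}"] unfolding bounded_iff by blast
  have "norm (f t) \<le> B" for t
  proof -
    let ?n = "\<lfloor>t / (2 * pi)\<rfloor>"
    have "of_int ?n * (2 * pi) \<le> t" "t < (of_int ?n + 1) * (2 * pi)"
      using floor_divide_lower[of "2 * pi" t] floor_divide_upper[of "2 * pi" t] by simp_all
    then have "t + of_int (- ?n) * (2 * pi) \<in> {0..2 * pi}" by (simp add: algebra_simps)
    from B[OF this] show ?thesis
      using periodic_int[where f=f and n="- ?n" and z=t, OF assms(1)] by simp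
  qed
  then show ?thesis by (rule that)
qed

text \<open>The form is bilinear, not sesquilinear: the operators below have real coefficients, and for this
form they are symmetric or skew without any conjugation.\<close>

definition pairing :: "(real \<Rightarrow> complex) \<Rightarrow> (real \<Rightarrow> complex) \<Rightarrow> complex"
  where "pairing f g = integral {0..2 * pi} (\<lambda>z. f z * g z)"

lemma integral_derivative_periodic:
  fixes C :: "real \<Rightarrow> complex"
  assumes "\<And>t. (C has_vector_derivative c t) (at t)"
  shows "integral {0..2 * pi} c = C (2 * pi) - C 0"
  using assms by (intro integral_unique fundamental_theorem_of_calculus)
    (auto intro: has_vector_derivative_at_within)

lemma pairing_combine:
  assumes "smooth_periodic f" "smooth_periodic g" "smooth_periodic h"
  shows "pairing f (\<lambda>z. a * g z + b * h z) = a * pairing f g + b * pairing f h"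
proof -
  have c: "continuous_on {0..2 * pi} f" "continuous_on {0..2 * pi} g" "continuous_on {0..2 * pi} h"
    using assms by (auto intro: smooth_real_continuous smooth_periodicD)
  have "pairing f (\<lambda>z. a * g z + b * h z) = integral {0..2 * pi} (\<lambda>z. a * (f z * g z) + b * (f z * h z))"
    unfolding pairing_def by (simp add: algebra_simps)
  also have "\<dots> = integral {0..2 * pi} (\<lambda>z. a * (f z * g z)) + integral {0..2 * pi} (\<lambda>z. b * (f z * h z))"
    by (intro integral_add integrable_continuous_real continuous_intros c)
  finally show ?thesis by (simp add: pairing_def)
qed

lemma pairing_commute: "pairing f g = pairing g f"
  by (simp add: pairing_def mult.commute)

lemma pairing_cmult: "pairing f (\<lambda>z. a * g z) = a * pairing f g"
  unfolding pairing_def by (simp add: mult.left_commute)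

lemma pairing_ddz:
  assumes f: "smooth_periodic f" and g: "smooth_periodic g"
  shows "pairing f (ddz g) = - pairing (ddz f) g"
proof -
  have "integral {0..2 * pi} (\<lambda>z. f z * ddz g z + ddz f z * g z) = f (2 * pi) * g (2 * pi) - f 0 * g 0"
    using smooth_real_ddz(1)[OF smooth_periodicD(1)] f g
    by (intro integral_derivative_periodic has_vector_derivative_mult) auto
  also have "\<dots> = 0"
    using smooth_periodicD(2)[OF f, of 0] smooth_periodicD(2)[OF g, of 0] by simp
  also have "integral {0..2 * pi} (\<lambda>z. f z * ddz g z + ddz f z * g z) = pairing f (ddz g) + pairing (ddz f) g"
    unfolding pairing_def
    by (intro integral_add integrable_continuous_real continuous_intros smooth_real_continuous
        smooth_periodicD smooth_periodic_ddz f g)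
  finally show ?thesis by (simp add: add_eq_0_iff2)
qed

lemma pairing_ddz_iter:
  assumes "smooth_periodic f" and "smooth_periodic g"
  shows "pairing f ((ddz ^^ i) g) = (- 1) ^ i * pairing ((ddz ^^ i) f) g"
  using assms
proof (induction i arbitrary: f)
  case (Suc i)
  have "pairing f ((ddz ^^ Suc i) g) = - pairing (ddz f) ((ddz ^^ i) g)"
    using pairing_ddz[of f "(ddz ^^ i) g"] Suc.prems by (simp add: smooth_periodic_ddz_iter)
  also have "\<dots> = - ((- 1) ^ i * pairing ((ddz ^^ i) (ddz f)) g)"
    using Suc by (simp add: smooth_periodic_ddz)
  finally show ?case by (simp add: funpow_swap1)
qed simp

section \<open>The Fredholm alternative\<close>

text \<open>The values of a function and of its first three derivatives at one point, the state space of the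
first-order system equivalent to a fourth-order equation.\<close>

type_synonym jet = "complex \<times> complex \<times> complex \<times> complex"

lemma norm_jet_le: "norm ((a, b, c, d) :: jet) \<le> norm a + norm b + norm c + norm d"
  using norm_Pair_le[of a "(b, c, d)"] norm_Pair_le[of b "(c, d)"] norm_Pair_le[of c d] by linarith

lemma norm_le_jet:
  "norm a \<le> norm ((a, b, c, d) :: jet)" "norm b \<le> norm ((a, b, c, d) :: jet)"
  "norm c \<le> norm ((a, b, c, d) :: jet)" "norm d \<le> norm ((a, b, c, d) :: jet)"
proof -
  show "norm a \<le> norm ((a, b, c, d) :: jet)" by (metis fst_conv norm_fst_le)
  show "norm b \<le> norm ((a, b, c, d) :: jet)" by (metis fst_conv snd_conv norm_fst_le norm_snd_le order_trans)
  show "norm c \<le> norm ((a, b, c, d) :: jet)" by (metis fst_conv snd_conv norm_fst_le norm_snd_le order_trans)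
  show "norm d \<le> norm ((a, b, c, d) :: jet)" by (metis snd_conv norm_snd_le order_trans)
qed

text \<open>The operator \<open>L0 v = k\<^sup>4 v'''' + \<sigma> k\<^sup>2 v'' + q v\<close> with a smooth \<open>2\<pi>\<close>-periodic potential \<open>q\<close>; for the
linearization at a wave profile, \<open>q = V'' \<circ> u\<close>.\<close>

locale periodic_operator =
  fixes k \<sigma> :: real and q :: "real \<Rightarrow> real"
  assumes k_nonzero: "k \<noteq> 0" and q_smooth: "smooth_on UNIV q"
    and q_periodic: "\<And>z. q (z + 2 * pi) = q z"
begin

definition L0 :: "(real \<Rightarrow> complex) \<Rightarrow> real \<Rightarrow> complex"
  where "L0 v z = of_real (k ^ 4) * (ddz ^^ 4) v z + of_real (\<sigma> * k\<^sup>2) * (ddz ^^ 2) v z + of_real (q z) * v z"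

text \<open>The equation \<open>L0 v = k\<^sup>4 f\<close> for the jet of \<open>v\<close>; dividing by \<open>k\<^sup>4\<close> makes the last component explicit.\<close>

definition system :: "(real \<Rightarrow> complex) \<Rightarrow> real \<Rightarrow> jet \<Rightarrow> jet"
  where "system f t x = (case x of (a, b, c, d) \<Rightarrow>
    (b, c, d, f t - of_real (\<sigma> / k\<^sup>2) * c - of_real (q t / k ^ 4) * a))"

definition solves :: "(real \<Rightarrow> complex) \<Rightarrow> (real \<Rightarrow> jet) \<Rightarrow> bool"
  where "solves f w \<longleftrightarrow> (\<forall>t. (w has_vector_derivative system f t (w t)) (at t))"

lemma q_continuous: "continuous_on X q"
  by (rule smooth_real_continuous[OF q_smooth])

lemma system_lipschitz: "\<exists>K. \<forall>f t x y. norm (system f t x - system f t y) \<le> K * norm (x - y)"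
proof -
  obtain Q where Q: "\<And>t. norm (q t) \<le> Q"
    using periodic_continuous_bounded[of q, OF q_periodic q_continuous] by blast
  have "norm (system f t x - system f t y) \<le> (3 + \<bar>\<sigma> / k\<^sup>2\<bar> + Q / k ^ 4) * norm (x - y)" for f t x y
  proof -
    obtain a b c d where xy: "x - y = (a, b, c, d)" by (metis prod_cases4)
    let ?l = "- (of_real (\<sigma> / k\<^sup>2) * c) - of_real (q t / k ^ 4) * a"
    have "system f t x - system f t y = (b, c, d, ?l)"
      using xy by (cases x; cases y) (auto simp: system_def algebra_simps add_divide_distrib)
    then have "norm (system f t x - system f t y) \<le> norm b + norm c + norm d + norm ?l"
      by (simp only: norm_jet_le)
    moreover have "norm ?l \<le> \<bar>\<sigma> / k\<^sup>2\<bar> * norm c + Q / k ^ 4 * norm a"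
    proof -
      have "norm ?l \<le> norm (of_real (\<sigma> / k\<^sup>2) * c) + norm (of_real (q t / k ^ 4) * a)"
        using norm_triangle_ineq4[of "- (of_real (\<sigma> / k\<^sup>2) * c)" "of_real (q t / k ^ 4) * a"]
        by (simp only: norm_minus_cancel)
      also have "\<dots> = \<bar>\<sigma> / k\<^sup>2\<bar> * norm c + \<bar>q t\<bar> / k ^ 4 * norm a"
        by (simp add: norm_mult norm_divide norm_power power_even_abs abs_mult)
      also have "\<dots> \<le> \<bar>\<sigma> / k\<^sup>2\<bar> * norm c + Q / k ^ 4 * norm a"
        using Q[of t] by (intro add_left_mono mult_right_mono divide_right_mono) auto
      finally show ?thesis .
    qed
    moreover have "Q \<ge> 0" using order_trans[OF norm_ge_zero Q[of 0]] .
    moreover have n: "norm a \<le> norm (x - y)" "norm b \<le> norm (x - y)" "norm c \<le> norm (x - y)"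
        "norm d \<le> norm (x - y)"
      unfolding xy by (rule norm_le_jet)+
    moreover have "\<bar>\<sigma> / k\<^sup>2\<bar> * norm c \<le> \<bar>\<sigma> / k\<^sup>2\<bar> * norm (x - y)"
      using n(3) by (intro mult_left_mono) auto
    moreover have "Q / k ^ 4 * norm a \<le> Q / k ^ 4 * norm (x - y)"
      using n(1) \<open>Q \<ge> 0\<close> by (intro mult_left_mono) auto
    ultimately have "norm (system f t x - system f t y) \<le>
      norm (x - y) + norm (x - y) + norm (x - y) + (\<bar>\<sigma> / k\<^sup>2\<bar> * norm (x - y) + Q / k ^ 4 * norm (x - y))"
      by linarith
    then show ?thesis by (simp add: algebra_simps)
  qed
  then show ?thesis by blast
qed

lemma solves_unique:
  assumes "solves f v" "solves f w" "v 0 = w 0"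
  shows "v = w"
  using system_lipschitz lipschitz_ode_unique[of "system f" _ v w] assms
  unfolding solves_def by blast

lemma solves_exists:
  assumes "smooth_periodic f"
  shows "\<exists>w. w 0 = x \<and> solves f w"
proof -
  note f = smooth_periodicD[OF assms]
  have fc: "continuous_on X f" for X by (rule smooth_real_continuous[OF f(1)])
  obtain G where G: "\<And>t. norm (f t) \<le> G"
    using periodic_continuous_bounded[of f, OF f(2) fc] by blast
  obtain K where K: "\<And>t x y. norm (system f t x - system f t y) \<le> K * norm (x - y)"
    using system_lipschitz by blast
  have "system f t 0 = (0, 0, 0, f t)" for t
    by (simp add: system_def zero_prod_def)
  then have bnd: "norm (system f t 0) \<le> G" for t
    using norm_jet_le[of 0 0 0 "f t"] G[of t] by simp
  have "continuous_on UNIV (\<lambda>p. system f (fst p) (snd p))"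
    unfolding system_def split_beta
    by (intro continuous_intros continuous_on_compose2[OF fc[of UNIV]] continuous_on_compose2[OF q_continuous[of UNIV]])
      (use k_nonzero in auto)
  from lipschitz_ode_global_solution[OF this K bnd, of x] show ?thesis
    unfolding solves_def .
qed

lemma solves_components:
  assumes "solves f w"
  shows "\<exists>a b c d. w = (\<lambda>t. (a t, b t, c t, d t)) \<and>
    (\<forall>t. (a has_vector_derivative b t) (at t)) \<and> (\<forall>t. (b has_vector_derivative c t) (at t)) \<and>
    (\<forall>t. (c has_vector_derivative d t) (at t)) \<and>
    (\<forall>t. (d has_vector_derivative f t - of_real (\<sigma> / k\<^sup>2) * c t - of_real (q t / k ^ 4) * a t) (at t))"
proof -
  define a b c d where "a t = fst (w t)" and "b t = fst (snd (w t))"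
    and "c t = fst (snd (snd (w t)))" and "d t = snd (snd (snd (w t)))" for t
  have w: "w = (\<lambda>t. (a t, b t, c t, d t))" by (auto simp: a_def b_def c_def d_def)
  have dw: "(w has_vector_derivative system f t (w t)) (at t)" for t
    using assms by (simp add: solves_def)
  note 1 = bounded_linear.has_vector_derivative[OF bounded_linear_fst]
  note 2 = bounded_linear.has_vector_derivative[OF bounded_linear_snd]
  show ?thesis
  proof (intro exI conjI allI, rule w)
    fix t
    have s: "system f t (w t) =
        (b t, c t, d t, f t - of_real (\<sigma> / k\<^sup>2) * c t - of_real (q t / k ^ 4) * a t)"
      by (simp add: w system_def)
    note d = dw[of t, unfolded s]
    show "(a has_vector_derivative b t) (at t)"
      using 1[OF d] by (simp add: a_def[abs_def])
    show "(b has_vector_derivative c t) (at t)"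
      using 1[OF 2[OF d]] by (simp add: b_def[abs_def])
    show "(c has_vector_derivative d t) (at t)"
      using 1[OF 2[OF 2[OF d]]] by (simp add: c_def[abs_def])
    show "(d has_vector_derivative f t - of_real (\<sigma> / k\<^sup>2) * c t - of_real (q t / k ^ 4) * a t) (at t)"
      using 2[OF 2[OF 2[OF d]]] by (simp add: d_def[abs_def])
  qed
qed

text \<open>Bootstrapping: if all components of the jet are \<open>C\<^sup>n\<close>, then so are their derivatives, since the
coefficients and the right-hand side are smooth, and hence the components are \<open>C\<^sup>n\<^sup>+\<^sup>1\<close>.\<close>

lemma solves_smooth:
  assumes "solves f w" "smooth_on UNIV f"
  shows "smooth_on UNIV (\<lambda>t. fst (w t))"
    and "(ddz ^^ 4) (\<lambda>t. fst (w t)) z = f z - of_real (\<sigma> / k\<^sup>2) * (ddz ^^ 2) (\<lambda>t. fst (w t)) z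
      - of_real (q z / k ^ 4) * fst (w z)"
    and "w z = (fst (w z), ddz (\<lambda>t. fst (w t)) z, (ddz ^^ 2) (\<lambda>t. fst (w t)) z, (ddz ^^ 3) (\<lambda>t. fst (w t)) z)"
proof -
  obtain a b c d where w: "w = (\<lambda>t. (a t, b t, c t, d t))"
    and a: "\<And>t. (a has_vector_derivative b t) (at t)" and b: "\<And>t. (b has_vector_derivative c t) (at t)"
    and c: "\<And>t. (c has_vector_derivative d t) (at t)"
    and d: "\<And>t. (d has_vector_derivative f t - of_real (\<sigma> / k\<^sup>2) * c t - of_real (q t / k ^ 4) * a t) (at t)"
    using solves_components[OF assms(1)] by blast
  have "C_n_on n UNIV a \<and> C_n_on n UNIV b \<and> C_n_on n UNIV c \<and> C_n_on n UNIV d" for n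
  proof (induction n)
    case 0
    show ?case
      unfolding C_n_on.simps(1) continuous_on_eq_continuous_within
      using a b c d by (blast intro: has_vector_derivative_continuous)
  next
    case (Suc n)
    have "C_n_on n UNIV (\<lambda>t. (- 1 / k ^ 4) *\<^sub>R (q t *\<^sub>R a t))"
      using q_smooth Suc unfolding smooth_on_def
      by (intro C_n_on_bounded_linear[OF bounded_linear_scaleR_right] C_n_on_scaleR) auto
    moreover have "C_n_on n UNIV (\<lambda>t. (- \<sigma> / k\<^sup>2) *\<^sub>R c t)"
      using Suc by (intro C_n_on_bounded_linear[OF bounded_linear_scaleR_right]) auto
    ultimately have "C_n_on n UNIV (\<lambda>t. f t + (- \<sigma> / k\<^sup>2) *\<^sub>R c t + (- 1 / k ^ 4) *\<^sub>R (q t *\<^sub>R a t))"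
      using assms(2) unfolding smooth_on_def by (intro C_n_on_add) auto
    also have "(\<lambda>t. f t + (- \<sigma> / k\<^sup>2) *\<^sub>R c t + (- 1 / k ^ 4) *\<^sub>R (q t *\<^sub>R a t)) =
      (\<lambda>t. f t - of_real (\<sigma> / k\<^sup>2) * c t - of_real (q t / k ^ 4) * a t)"
      by (simp add: scaleR_conv_of_real)
    finally have "C_n_on (Suc n) UNIV d"
      unfolding C_n_on_Suc_real using d
      by (intro exI[of _ "\<lambda>t. f t - of_real (\<sigma> / k\<^sup>2) * c t - of_real (q t / k ^ 4) * a t"] conjI allI)
    moreover have "C_n_on (Suc n) UNIV a" "C_n_on (Suc n) UNIV b" "C_n_on (Suc n) UNIV c"
      using a b c Suc unfolding C_n_on_Suc_real by blast+
    ultimately show ?case by simp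
  qed
  moreover have D: "ddz a = b" "ddz b = c" "ddz c = d"
      "ddz d = (\<lambda>t. f t - of_real (\<sigma> / k\<^sup>2) * c t - of_real (q t / k ^ 4) * a t)"
    using a b c d by (auto intro: ddz_eqI)
  ultimately show "smooth_on UNIV (\<lambda>t. fst (w t))"
    "(ddz ^^ 4) (\<lambda>t. fst (w t)) z = f z - of_real (\<sigma> / k\<^sup>2) * (ddz ^^ 2) (\<lambda>t. fst (w t)) z
      - of_real (q z / k ^ 4) * fst (w z)"
    "w z = (fst (w z), ddz (\<lambda>t. fst (w t)) z, (ddz ^^ 2) (\<lambda>t. fst (w t)) z, (ddz ^^ 3) (\<lambda>t. fst (w t)) z)"
    by (simp_all add: w smooth_on_def eval_nat_numeral)
qed

text \<open>Translation by the period maps solutions to solutions, so by uniqueness a solution whose jet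
returns after one period is periodic.\<close>

lemma solves_periodic:
  assumes w: "solves f w" and f: "smooth_periodic f" and per: "w (2 * pi) = w 0"
  shows "smooth_periodic (\<lambda>t. fst (w t))" and "L0 (\<lambda>t. fst (w t)) z = of_real (k ^ 4) * f z"
proof -
  note fs = smooth_periodicD[OF f]
  have "solves f (\<lambda>t. w (t + 2 * pi))"
    unfolding solves_def
  proof
    fix t
    have "((\<lambda>t. t + 2 * pi) has_vector_derivative 1) (at t)"
      by (auto intro!: derivative_eq_intros)
    from vector_diff_chain_at[OF this, of w "system f (t + 2 * pi) (w (t + 2 * pi))"] w
    have "((\<lambda>t. w (t + 2 * pi)) has_vector_derivative system f (t + 2 * pi) (w (t + 2 * pi))) (at t)"
      by (simp add: o_def solves_def)
    then show "((\<lambda>t. w (t + 2 * pi)) has_vector_derivative system f t (w (t + 2 * pi))) (at t)"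
      by (simp add: system_def fs(2) q_periodic)
  qed
  then have "(\<lambda>t. w (t + 2 * pi)) = w"
    using solves_unique[OF _ w] per by simp
  then have "w (t + 2 * pi) = w t" for t by metis
  then show "smooth_periodic (\<lambda>t. fst (w t))"
    using solves_smooth(1)[OF w fs(1)] by (simp add: smooth_periodic_def)
  show "L0 (\<lambda>t. fst (w t)) z = of_real (k ^ 4) * f z"
    unfolding L0_def solves_smooth(2)[OF w fs(1)] using k_nonzero
    by (simp add: field_simps power4_eq_xxxx power2_eq_square)
qed

text \<open>The bilinear concomitant of \<open>L0\<close>, the boundary term in Lagrange's identity: the derivative of
\<open>concomitant \<phi> t (jet of v at t)\<close> is \<open>\<phi> * L0 v - v * L0 \<phi>\<close>.\<close>

definition concomitant :: "(real \<Rightarrow> complex) \<Rightarrow> real \<Rightarrow> jet \<Rightarrow> complex"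
  where "concomitant \<phi> t x = (case x of (a, b, c, d) \<Rightarrow>
     of_real (k ^ 4) * (\<phi> t * d - ddz \<phi> t * c + (ddz ^^ 2) \<phi> t * b - (ddz ^^ 3) \<phi> t * a)
     + of_real (\<sigma> * k\<^sup>2) * (\<phi> t * b - ddz \<phi> t * a))"

lemma concomitant_derivative:
  assumes w: "solves f w" and \<phi>: "smooth_periodic \<phi>" "\<And>z. L0 \<phi> z = 0"
  shows "((\<lambda>t. concomitant \<phi> t (w t)) has_vector_derivative of_real (k ^ 4) * (\<phi> t * f t)) (at t)"
proof -
  obtain a b c d where w': "w = (\<lambda>t. (a t, b t, c t, d t))"
    and a: "\<And>t. (a has_vector_derivative b t) (at t)" and b: "\<And>t. (b has_vector_derivative c t) (at t)"
    and c: "\<And>t. (c has_vector_derivative d t) (at t)"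
    and d: "\<And>t. (d has_vector_derivative f t - of_real (\<sigma> / k\<^sup>2) * c t - of_real (q t / k ^ 4) * a t) (at t)"
    using solves_components[OF w] by blast
  let ?p = "\<lambda>i. (ddz ^^ i) \<phi>"
  note p = ddz_iter_has_derivative[OF \<phi>(1)]
  have p0: "(\<phi> has_vector_derivative ddz \<phi> t) (at t)" and p1: "(ddz \<phi> has_vector_derivative ?p 2 t) (at t)"
    and p2: "(?p 2 has_vector_derivative ?p 3 t) (at t)" and p3: "(?p 3 has_vector_derivative ?p 4 t) (at t)"
    using p[of 0 t] p[of 1 t] p[of 2 t] p[of 3 t] by (simp_all add: eval_nat_numeral)
  let ?K = "of_real (k ^ 4) :: complex" and ?S = "of_real (\<sigma> * k\<^sup>2) :: complex"
  let ?X = "f t - of_real (\<sigma> / k\<^sup>2) * c t - of_real (q t / k ^ 4) * a t"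
  have X: "?K * ?X = ?K * f t - ?S * c t - of_real (q t) * a t"
    using k_nonzero by (simp add: field_simps power4_eq_xxxx power2_eq_square)
  have p4: "?K * ?p 4 t = - (?S * ?p 2 t) - of_real (q t) * \<phi> t"
    using \<phi>(2)[of t] unfolding L0_def by algebra
  have alg: "K * ((p0 * x + p1 * d - (p1 * d + p2 * c)) + (p2 * c + p3 * b) - (p3 * b + p4 * a))
    + S * (p0 * c + p1 * b - (p1 * b + p2 * a)) = p0 * (K * x) - (K * p4) * a + S * (p0 * c) - S * (p2 * a)"
    for K S p0 p1 p2 p3 p4 a b c d x :: complex
    by (simp add: algebra_simps)
  note m = has_vector_derivative_mult
  note D = has_vector_derivative_add[OF
    has_vector_derivative_mult_right[OF has_vector_derivative_diff[OF
      has_vector_derivative_add[OF has_vector_derivative_diff[OF m[OF p0 d] m[OF p1 c]] m[OF p2 b]] m[OF p3 a]]]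
    has_vector_derivative_mult_right[OF has_vector_derivative_diff[OF m[OF p0 b] m[OF p1 a]]],
    of ?K ?S]
  show ?thesis
    unfolding w' concomitant_def prod.case
    by (rule has_vector_derivative_eq_rhs[OF D]) (simp only: alg X p4, simp add: algebra_simps)
qed

text \<open>Lagrange's identity over one period: solvability of the equation forces the increment of the jet
into the kernel of one linear functional, given by the jet of \<open>\<phi>\<close> at \<open>0\<close>.\<close>

lemma concomitant_increment:
  assumes w: "solves f w" and \<phi>: "smooth_periodic \<phi>" "\<And>z. L0 \<phi> z = 0"
    and "pairing \<phi> f = 0"
  shows "concomitant \<phi> 0 (w (2 * pi) - w 0) = 0"
proof -
  have "integral {0..2 * pi} (\<lambda>t. of_real (k ^ 4) * (\<phi> t * f t)) =
      concomitant \<phi> (2 * pi) (w (2 * pi)) - concomitant \<phi> 0 (w 0)"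
    by (rule integral_derivative_periodic[OF concomitant_derivative[OF w \<phi>]])
  moreover have "integral {0..2 * pi} (\<lambda>t. of_real (k ^ 4) * (\<phi> t * f t)) = of_real (k ^ 4) * pairing \<phi> f"
    unfolding pairing_def by (rule integral_mult_right)
  moreover have "(ddz ^^ i) \<phi> (2 * pi) = (ddz ^^ i) \<phi> 0" for i
    using smooth_periodicD(2)[OF smooth_periodic_ddz_iter[OF \<phi>(1)], of i 0] by simp
  from this[of 0] this[of 1] this[of 2] this[of 3]
  have "concomitant \<phi> (2 * pi) x = concomitant \<phi> 0 x" for x
    by (simp add: concomitant_def)
  moreover have "concomitant \<phi> 0 (w (2 * pi) - w 0) = concomitant \<phi> 0 (w (2 * pi)) - concomitant \<phi> 0 (w 0)"
    by (cases "w (2 * pi)"; cases "w 0") (simp add: concomitant_def algebra_simps)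
  ultimately show ?thesis using assms(4) by simp
qed

text \<open>Periodic solutions correspond to initial jets whose solution returns after one period. Let \<open>T\<close> be
the linear map taking an initial jet to the increment of the homogeneous solution over a period.
Its kernel is spanned by the jet \<open>U\<close> of \<open>\<phi>\<close>, and by \<open>concomitant_increment\<close> its range lies in the
kernel of a functional \<open>B\<close>. The map \<open>S = T + E \<circ> J\<close> adds a rank-one correction: \<open>J\<close> is the inner
product with \<open>U\<close>, and \<open>E\<close> points in the direction dual to \<open>B\<close>. Applying \<open>B\<close> to
\<open>S x\<close> isolates \<open>J x\<close>; so \<open>S x = 0\<close> gives \<open>J x = 0\<close> and \<open>T x = 0\<close>, which makes \<open>x\<close> a multiple of \<open>U\<close>
orthogonal to \<open>U\<close>. Hence \<open>S\<close> is injective, and surjective on the finite-dimensional jet space. The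
increment that has to be cancelled, that of a particular solution, lies in the kernel of \<open>B\<close>; a
preimage of it under \<open>S\<close> therefore has \<open>J x = 0\<close> and is a preimage under \<open>T\<close>.\<close>

theorem fredholm_alternative:
  assumes \<phi>: "smooth_periodic \<phi>" "\<And>z. L0 \<phi> z = 0"
    and kernel: "\<And>v. smooth_periodic v \<Longrightarrow> (\<And>z. L0 v z = 0) \<Longrightarrow> \<exists>c. v = (\<lambda>z. c * \<phi> z)"
    and f: "smooth_periodic f" "pairing \<phi> f = 0"
  shows "\<exists>v. smooth_periodic v \<and> (\<forall>z. L0 v z = f z)"
proof -
  define W where "W x = (SOME w. w 0 = x \<and> solves (\<lambda>_. 0) w)" for x
  have zero: "smooth_periodic (\<lambda>_. 0)"
    using smooth_periodic_cmult[OF f(1), of 0] by simp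
  have W: "W x 0 = x" "solves (\<lambda>_. 0) (W x)" for x
    using someI_ex[OF solves_exists[OF zero, of x]] unfolding W_def by auto
  have Wd: "(W x has_vector_derivative system (\<lambda>_. 0) t (W x t)) (at t)" for x t
    using W(2)[of x] by (simp add: solves_def)
  have W_eq: "W x = w" if "solves (\<lambda>_. 0) w" "w 0 = x" for w x
    using solves_unique[OF W(2) that(1)] W(1) that(2) by simp
  \<comment> \<open>the monodromy map minus the identity\<close>
  define T where "T x = W x (2 * pi) - x" for x
  have "linear W'" if "W' = (\<lambda>x. W x t)" for W' t
  proof (rule linearI)
    fix x y :: jet and r :: real
    have "solves (\<lambda>_. 0) (\<lambda>t. W x t + W y t)"
      unfolding solves_def
    proof
      fix t
      have "system (\<lambda>_. 0) t (W x t + W y t) = system (\<lambda>_. 0) t (W x t) + system (\<lambda>_. 0) t (W y t)"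
        by (cases "W x t"; cases "W y t") (simp add: system_def algebra_simps add_divide_distrib)
      then show "((\<lambda>t. W x t + W y t) has_vector_derivative system (\<lambda>_. 0) t (W x t + W y t)) (at t)"
        using has_vector_derivative_add[OF Wd[of x t] Wd[of y t]] by simp
    qed
    from W_eq[OF this, of "x + y"] show "W' (x + y) = W' x + W' y"
      using that W(1) by simp
    have "solves (\<lambda>_. 0) (\<lambda>t. r *\<^sub>R W x t)"
      unfolding solves_def
    proof
      fix t
      have "system (\<lambda>_. 0) t (r *\<^sub>R W x t) = r *\<^sub>R system (\<lambda>_. 0) t (W x t)"
        by (cases "W x t") (simp add: system_def scaleR_conv_of_real algebra_simps)
      then show "((\<lambda>t. r *\<^sub>R W x t) has_vector_derivative system (\<lambda>_. 0) t (r *\<^sub>R W x t)) (at t)"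
        using bounded_linear.has_vector_derivative[OF bounded_linear_scaleR_right Wd[of x t], of r]
        by simp
    qed
    from W_eq[OF this, of "r *\<^sub>R x"] show "W' (r *\<^sub>R x) = r *\<^sub>R W' x"
      using that W(1) by simp
  qed
  then have "linear (\<lambda>x. W x (2 * pi))" by blast
  then have T_linear: "linear T"
    unfolding T_def[abs_def] by (intro linear_compose_sub linear_ident)
  obtain U0 U1 U2 U3 where U: "U0 = \<phi> 0" "U1 = ddz \<phi> 0" "U2 = (ddz ^^ 2) \<phi> 0" "U3 = (ddz ^^ 3) \<phi> 0"
    by blast
  define J where "J x = (case x of (a, b, c, d) \<Rightarrow> a * cnj U0 + b * cnj U1 + c * cnj U2 + d * cnj U3)"
    for x :: jet
  let ?K = "of_real (k ^ 4) :: complex" and ?S = "of_real (\<sigma> * k\<^sup>2) :: complex"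
  \<comment> \<open>the coefficients of the functional \<open>B\<close>; they vanish together only if the jet of \<open>\<phi>\<close> at \<open>0\<close> does\<close>
  define N0 N1 N2 N3 where "N0 = - (?K * U3) - ?S * U1" and "N1 = ?K * U2 + ?S * U0"
    and "N2 = - (?K * U1)" and "N3 = ?K * U0"
  note N = N0_def N1_def N2_def N3_def
  define B where "B = concomitant \<phi> 0"
  have B: "B (a, b, c, d) = N0 * a + N1 * b + N2 * c + N3 * d" for a b c d
    by (simp add: B_def concomitant_def N U algebra_simps)
  \<comment> \<open>conjugation makes \<open>B (E r)\<close> a sum of squares times \<open>r\<close>\<close>
  define E where "E r = (r * cnj N0, r * cnj N1, r * cnj N2, r * cnj N3)" for r
  define S where "S x = T x + E (J x)" for x
  have "linear (\<lambda>x. E (J x))"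
    by (rule linearI) (auto simp: E_def J_def scaleR_conv_of_real algebra_simps split: prod.splits)
  then have S_linear: "linear S"
    unfolding S_def[abs_def] by (intro linear_compose_add T_linear)
  have BN: "B (E r) = r * of_real ((cmod N0)\<^sup>2 + (cmod N1)\<^sup>2 + (cmod N2)\<^sup>2 + (cmod N3)\<^sup>2)" for r
    unfolding E_def B of_real_add complex_norm_square by (simp add: algebra_simps)
  have B_add: "B (x + y) = B x + B y" for x y
    by (cases x; cases y) (simp add: B algebra_simps)
  have BT: "B (T x) = 0" for x
    using concomitant_increment[OF W(2)[of x] \<phi>] by (simp add: W(1) T_def B_def pairing_def)
  \<comment> \<open>if \<open>B\<close> vanishes, then the jet \<open>U\<close> does, and with it \<open>J\<close>\<close>
  have J_zero: "J x = 0" if "B (E (J x)) = 0" for x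
  proof (cases "J x = 0")
    case False
    with that have "(cmod N0)\<^sup>2 + (cmod N1)\<^sup>2 + (cmod N2)\<^sup>2 + (cmod N3)\<^sup>2 = 0"
      unfolding BN by (metis mult_eq_0_iff of_real_eq_0_iff)
    then have "N0 = 0" "N1 = 0" "N2 = 0" "N3 = 0"
      by (simp_all add: add_nonneg_eq_0_iff)
    then have "U0 = 0" "U1 = 0" "U2 = 0" "U3 = 0"
      using k_nonzero by (simp_all add: N)
    then show ?thesis by (simp add: J_def split: prod.splits)
  qed
  have S_preimage: "T x = - h \<and> J x = 0" if "S x = - h" "B h = 0" for x h
  proof -
    have "B h + B (S x) = B 0" using that(1) by (simp flip: B_add)
    moreover have "B 0 = 0" using B[of 0 0 0 0] by (simp add: zero_prod_def)
    ultimately have "B (E (J x)) = 0" using that(2) BT by (simp add: S_def B_add)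
    then have "J x = 0" by (rule J_zero)
    then show ?thesis using that(1) by (simp add: S_def E_def zero_prod_def[symmetric])
  qed
  have "x = 0" if "S x = 0" for x
  proof -
    have "T x = 0" "J x = 0"
      using S_preimage[of x 0] that B[of 0 0 0 0] by (simp_all add: zero_prod_def)
    then have per: "W x (2 * pi) = W x 0" by (simp add: T_def W(1))
    obtain r where r: "(\<lambda>t. fst (W x t)) = (\<lambda>z. r * \<phi> z)"
      using kernel solves_periodic[OF W(2) zero per] by fastforce
    have "x = (r * U0, r * U1, r * U2, r * U3)"
      using solves_smooth(3)[OF W(2) smooth_periodicD(1)[OF zero], of x 0] fun_cong[OF r, of 0]
      unfolding r W(1) U ddz_iter_cmult[OF \<phi>(1)]
      using ddz_iter_cmult[OF \<phi>(1), of 1 r] by simp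
    moreover from this have "J x = r * of_real ((cmod U0)\<^sup>2 + (cmod U1)\<^sup>2 + (cmod U2)\<^sup>2 + (cmod U3)\<^sup>2)"
      unfolding of_real_add complex_norm_square by (simp add: J_def algebra_simps)
    with \<open>J x = 0\<close> have "r = 0 \<or> (cmod U0)\<^sup>2 + (cmod U1)\<^sup>2 + (cmod U2)\<^sup>2 + (cmod U3)\<^sup>2 = 0"
      by (metis mult_eq_0_iff of_real_eq_0_iff)
    then have "r = 0 \<or> U0 = 0 \<and> U1 = 0 \<and> U2 = 0 \<and> U3 = 0"
      by (simp add: add_nonneg_eq_0_iff)
    ultimately show ?thesis by (auto simp: zero_prod_def)
  qed
  then have "inj S"
    using S_linear by (simp add: linear_injective_0)
  then have S_surj: "surj S"
    by (rule linear_injective_imp_surjective[OF S_linear]) simp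
  define g where "g z = of_real (1 / k ^ 4) * f z" for z
  have g: "smooth_periodic g" "pairing \<phi> g = 0"
  proof -
    show "smooth_periodic g" unfolding g_def[abs_def] by (intro smooth_periodic_cmult f)
    have "pairing \<phi> g = integral {0..2 * pi} (\<lambda>z. of_real (1 / k ^ 4) * (\<phi> z * f z))"
      unfolding pairing_def g_def by (simp add: algebra_simps)
    also have "\<dots> = of_real (1 / k ^ 4) * pairing \<phi> f"
      unfolding pairing_def by (rule integral_mult_right)
    finally show "pairing \<phi> g = 0" using f(2) by simp
  qed
  obtain w where w: "w 0 = 0" "solves g w" using solves_exists[OF g(1)] by blast
  have "B (w (2 * pi)) = 0"
    using concomitant_increment[OF w(2) \<phi> g(2)] by (simp add: w(1) B_def)
  moreover obtain x where "S x = - w (2 * pi)" using S_surj by (metis surjD)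
  ultimately have Tx: "T x = - w (2 * pi)" using S_preimage by blast
  have "solves g (\<lambda>t. w t + W x t)"
    unfolding solves_def
  proof
    fix t
    have "system g t (w t + W x t) = system g t (w t) + system (\<lambda>_. 0) t (W x t)"
      by (cases "w t"; cases "W x t") (simp add: system_def algebra_simps add_divide_distrib)
    then show "((\<lambda>t. w t + W x t) has_vector_derivative system g t (w t + W x t)) (at t)"
      using has_vector_derivative_add[OF w(2)[unfolded solves_def, rule_format, of t] Wd[of x t]] by simp
  qed
  moreover have "w (2 * pi) + W x (2 * pi) = w 0 + W x 0"
    using Tx w(1) W(1) by (simp add: T_def algebra_simps)
  ultimately have "smooth_periodic (\<lambda>t. fst (w t + W x t))"
    "L0 (\<lambda>t. fst (w t + W x t)) z = of_real (k ^ 4) * g z" for z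
    using solves_periodic[OF _ g(1)] by blast+
  then show ?thesis using k_nonzero by (auto simp: g_def)
qed

end

section \<open>Solvability of the chain equations\<close>

context periodic_operator
begin

text \<open>The Taylor coefficients at \<open>0\<close> of the pencil, whose constant term is \<open>L0\<close>; see \<open>L_op_expansion\<close>.\<close>

definition L1 :: "(real \<Rightarrow> complex) \<Rightarrow> real \<Rightarrow> complex"
  where "L1 v z = of_real (4 * k ^ 3) * (ddz ^^ 3) v z + of_real (2 * \<sigma> * k) * ddz v z"

definition L2 :: "(real \<Rightarrow> complex) \<Rightarrow> real \<Rightarrow> complex"
  where "L2 v z = of_real (6 * k\<^sup>2) * (ddz ^^ 2) v z + of_real \<sigma> * v z"

definition L3 :: "(real \<Rightarrow> complex) \<Rightarrow> real \<Rightarrow> complex"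
  where "L3 v z = of_real (4 * k) * ddz v z"

lemma smooth_periodic_L:
  assumes "smooth_periodic v"
  shows "smooth_periodic (L0 v)" "smooth_periodic (L1 v)" "smooth_periodic (L2 v)" "smooth_periodic (L3 v)"
  unfolding L0_def[abs_def] L1_def[abs_def] L2_def[abs_def] L3_def[abs_def]
  by (intro smooth_periodic_intros smooth_periodic_of_real_mult q_smooth q_periodic assms)+

text \<open>Even powers of \<open>d/dz\<close> are symmetric and odd powers are skew for the pairing, by integration by parts
without boundary terms. So the Taylor coefficients alternate: \<open>L0\<close> and \<open>L2\<close> are symmetric, \<open>L1\<close>
and \<open>L3\<close> are skew.\<close>

lemma L0_symmetric:
  assumes f: "smooth_periodic f" and g: "smooth_periodic g"
  shows "pairing f (L0 g) = pairing (L0 f) g"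
proof -
  have q: "smooth_periodic (\<lambda>z. of_real (q z) * g z)" "smooth_periodic (\<lambda>z. of_real (q z) * f z)"
    by (intro smooth_periodic_of_real_mult q_smooth q_periodic f g)+
  have qfg: "pairing f (\<lambda>z. of_real (q z) * g z) = pairing (\<lambda>z. of_real (q z) * f z) g"
    by (simp add: pairing_def algebra_simps)
  have *: "pairing f (L0 g) = of_real (k ^ 4) * pairing f ((ddz ^^ 4) g)
      + of_real (\<sigma> * k\<^sup>2) * pairing f ((ddz ^^ 2) g) + pairing f (\<lambda>z. of_real (q z) * g z)"
    if f: "smooth_periodic f" and g: "smooth_periodic g"
      and q: "smooth_periodic (\<lambda>z. of_real (q z) * g z)" for f g
    using pairing_combine[OF f _ q, of "\<lambda>z. of_real (k ^ 4) * (ddz ^^ 4) g z + of_real (\<sigma> * k\<^sup>2) * (ddz ^^ 2) g z" 1 1]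
      pairing_combine[OF f, of "(ddz ^^ 4) g" "(ddz ^^ 2) g" "of_real (k ^ 4)" "of_real (\<sigma> * k\<^sup>2)"]
      smooth_periodic_intros g
    unfolding L0_def[abs_def] by auto
  show ?thesis
    unfolding *[OF f g q(1)] qfg pairing_commute[of "L0 f" g] *[OF g f q(2)]
    using pairing_ddz_iter[OF f g] by (simp add: pairing_commute[of g])
qed

lemma L1_skew:
  assumes f: "smooth_periodic f" and g: "smooth_periodic g"
  shows "pairing f (L1 g) = - pairing (L1 f) g"
proof -
  have *: "pairing f (L1 g) = of_real (4 * k ^ 3) * pairing f ((ddz ^^ 3) g)
      + of_real (2 * \<sigma> * k) * pairing f (ddz g)"
    if f: "smooth_periodic f" and g: "smooth_periodic g" for f g
    unfolding L1_def[abs_def] by (intro pairing_combine smooth_periodic_intros that)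
  show ?thesis
    unfolding *[OF f g] pairing_commute[of "L1 f" g] *[OF g f]
    using pairing_ddz_iter[OF f g, of 3] pairing_ddz[OF f g]
    by (simp add: pairing_commute[of g])
qed

lemma L2_symmetric:
  assumes f: "smooth_periodic f" and g: "smooth_periodic g"
  shows "pairing f (L2 g) = pairing (L2 f) g"
proof -
  have *: "pairing f (L2 g) = of_real (6 * k\<^sup>2) * pairing f ((ddz ^^ 2) g) + of_real \<sigma> * pairing f g"
    if f: "smooth_periodic f" and g: "smooth_periodic g" for f g
    unfolding L2_def[abs_def] by (intro pairing_combine smooth_periodic_intros that)
  show ?thesis
    unfolding *[OF f g] pairing_commute[of "L2 f" g] *[OF g f]
    using pairing_ddz_iter[OF f g, of 2]
    by (simp add: pairing_commute[of g])
qed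

lemma L3_skew:
  assumes f: "smooth_periodic f" and g: "smooth_periodic g"
  shows "pairing f (L3 g) = - pairing (L3 f) g"
  unfolding L3_def[abs_def] pairing_cmult pairing_commute[of "\<lambda>z. _ * ddz f z" g]
  using pairing_ddz[OF f g] by (simp add: pairing_commute[of g])

text \<open>Once the third chain equation is solvable, so is the fourth. With \<open>\<zeta>\<close> a solution of the third,
\<open>\<langle>\<phi>, L1 \<zeta>\<rangle> = - \<langle>L1 \<phi>, \<zeta>\<rangle> = \<langle>L0 \<psi>, \<zeta>\<rangle> = \<langle>\<psi>, L0 \<zeta>\<rangle> = - \<langle>\<psi>, L1 \<psi>\<rangle> - \<langle>\<psi>, L2 \<phi>\<rangle>\<close>. Here \<open>\<langle>\<psi>, L1 \<psi>\<rangle>\<close>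
vanishes by skewness, and the remaining term cancels \<open>\<langle>\<phi>, L2 \<psi>\<rangle>\<close>. Finally \<open>\<langle>\<phi>, L3 \<phi>\<rangle> = 0\<close>, again by
skewness, so the solvability condition for the fourth equation holds identically.\<close>

lemma chain_extension:
  assumes \<phi>: "smooth_periodic \<phi>" "\<And>z. L0 \<phi> z = 0"
    and kernel: "\<And>v. smooth_periodic v \<Longrightarrow> (\<And>z. L0 v z = 0) \<Longrightarrow> \<exists>c. v = (\<lambda>z. c * \<phi> z)"
    and \<psi>: "smooth_periodic \<psi>" "\<And>z. L0 \<psi> z = - L1 \<phi> z"
    and solvable: "pairing \<phi> (L1 \<psi>) + pairing \<phi> (L2 \<phi>) = 0"
  shows "\<exists>\<zeta> \<omega>. smooth_periodic \<zeta> \<and> (\<forall>z. L0 \<zeta> z = - (L1 \<psi> z + L2 \<phi> z)) \<and>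
    smooth_periodic \<omega> \<and> (\<forall>z. L0 \<omega> z = - (L1 \<zeta> z + L2 \<psi> z + L3 \<phi> z))"
proof -
  note sp = smooth_periodic_L
  let ?e = "\<lambda>z. - 1 * L1 \<psi> z + - 1 * L2 \<phi> z"
  have spe: "smooth_periodic ?e" by (intro smooth_periodic_intros sp \<phi> \<psi>)
  have "pairing \<phi> ?e = 0"
    using solvable by (subst pairing_combine) (auto intro: sp \<phi> \<psi> simp: add_eq_0_iff2)
  from fredholm_alternative[OF \<phi> kernel spe this] obtain \<zeta>
    where \<zeta>: "smooth_periodic \<zeta>" "\<And>z. L0 \<zeta> z = ?e z" by blast
  have "pairing \<phi> (L1 \<zeta>) = pairing (L0 \<psi>) \<zeta>"
    using L1_skew[OF \<phi>(1) \<zeta>(1)] \<psi>(2) by (simp add: pairing_def)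
  also have "\<dots> = pairing \<psi> (L0 \<zeta>)" using L0_symmetric[OF \<psi>(1) \<zeta>(1)] by simp
  also have "\<dots> = - 1 * pairing \<psi> (L1 \<psi>) + - 1 * pairing \<psi> (L2 \<phi>)"
    unfolding \<zeta>(2)[abs_def] by (intro pairing_combine sp \<phi> \<psi>)
  finally have 1: "pairing \<phi> (L1 \<zeta>) = - pairing \<psi> (L1 \<psi>) - pairing \<psi> (L2 \<phi>)" by simp
  have 2: "pairing \<psi> (L1 \<psi>) = 0"
    using L1_skew[OF \<psi>(1) \<psi>(1)] by (simp add: pairing_commute)
  have 3: "pairing \<phi> (L3 \<phi>) = 0"
    using L3_skew[OF \<phi>(1) \<phi>(1)] by (simp add: pairing_commute)
  have 4: "pairing \<psi> (L2 \<phi>) = pairing \<phi> (L2 \<psi>)"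
    using L2_symmetric[OF \<psi>(1) \<phi>(1)] by (simp add: pairing_commute)
  let ?f = "\<lambda>z. - 1 * (1 * L1 \<zeta> z + 1 * L2 \<psi> z) + - 1 * L3 \<phi> z"
  have spf: "smooth_periodic ?f" by (intro smooth_periodic_intros sp \<phi> \<psi> \<zeta>)
  have "pairing \<phi> ?f = - 1 * pairing \<phi> (\<lambda>z. 1 * L1 \<zeta> z + 1 * L2 \<psi> z) + - 1 * pairing \<phi> (L3 \<phi>)"
    by (intro pairing_combine smooth_periodic_intros sp \<phi> \<psi> \<zeta>)
  also have "pairing \<phi> (\<lambda>z. 1 * L1 \<zeta> z + 1 * L2 \<psi> z) = 1 * pairing \<phi> (L1 \<zeta>) + 1 * pairing \<phi> (L2 \<psi>)"
    by (intro pairing_combine sp \<phi> \<psi> \<zeta>)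
  finally have "pairing \<phi> ?f = 0" using 1 2 3 4 by simp
  from fredholm_alternative[OF \<phi> kernel spf this] obtain \<omega>
    where "smooth_periodic \<omega>" "\<And>z. L0 \<omega> z = ?f z" by blast
  with \<zeta> show ?thesis by (intro exI[of _ \<zeta>] exI[of _ \<omega>]) auto
qed

text \<open>Pairing the equation for \<open>\<eta>\<close> with \<open>\<phi>\<close> annihilates its left-hand side. The contribution of \<open>\<xi>\<close> is
computed as \<open>\<langle>\<phi>, L1 \<xi>\<rangle> = \<langle>L0 \<psi>, \<xi>\<rangle> = \<langle>\<psi>, L0 \<xi>\<rangle> = c * \<langle>\<phi>, L1 \<psi>\<rangle>\<close>, so that no explicit form of \<open>\<xi>\<close>
enters.\<close>

lemma chain_obstruction:
  assumes \<phi>: "smooth_periodic \<phi>" "\<And>z. L0 \<phi> z = 0"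
    and \<psi>: "smooth_periodic \<psi>" "\<And>z. L0 \<psi> z = - L1 \<phi> z"
    and "c \<noteq> 0"
    and \<xi>: "smooth_periodic \<xi>" "\<And>z. L0 \<xi> z = - L1 (\<lambda>z. c * \<phi> z) z"
    and \<eta>: "smooth_periodic \<eta>" "\<And>z. L0 \<eta> z = - (L1 \<xi> z + L2 (\<lambda>z. c * \<phi> z) z)"
  shows "pairing \<phi> (L1 \<psi>) + pairing \<phi> (L2 \<phi>) = 0"
proof -
  note sp = smooth_periodic_L
  have L1c: "L1 (\<lambda>z. c * \<phi> z) = (\<lambda>z. c * L1 \<phi> z)" and L2c: "L2 (\<lambda>z. c * \<phi> z) = (\<lambda>z. c * L2 \<phi> z)"
    using ddz_iter_cmult[OF \<phi>(1), of 1] ddz_iter_cmult[OF \<phi>(1)]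
    by (auto simp: L1_def[abs_def] L2_def[abs_def] algebra_simps)
  have "pairing \<phi> (\<lambda>z. - 1 * L1 \<xi> z + - c * L2 \<phi> z) = pairing (L0 \<phi>) \<eta>"
    using L0_symmetric[OF \<phi>(1) \<eta>(1)] \<eta>(2)[abs_def] by (simp add: L2c)
  also have "\<dots> = 0" using \<phi>(2) by (simp add: pairing_def)
  also have "pairing \<phi> (\<lambda>z. - 1 * L1 \<xi> z + - c * L2 \<phi> z) = - 1 * pairing \<phi> (L1 \<xi>) + - c * pairing \<phi> (L2 \<phi>)"
    by (intro pairing_combine sp \<phi> \<xi>)
  finally have 1: "pairing \<phi> (L1 \<xi>) = - c * pairing \<phi> (L2 \<phi>)" by algebra
  have "pairing \<phi> (L1 \<xi>) = pairing (L0 \<psi>) \<xi>"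
    using L1_skew[OF \<phi>(1) \<xi>(1)] \<psi>(2) by (simp add: pairing_def)
  also have "\<dots> = pairing \<psi> (\<lambda>z. - c * L1 \<phi> z)"
    using L0_symmetric[OF \<psi>(1) \<xi>(1)] \<xi>(2)[abs_def] by (simp add: L1c)
  also have "\<dots> = c * pairing \<phi> (L1 \<psi>)"
    using L1_skew[OF \<psi>(1) \<phi>(1)] unfolding pairing_cmult by (simp add: pairing_commute)
  finally have "c * (pairing \<phi> (L1 \<psi>) + pairing \<phi> (L2 \<phi>)) = 0"
    using 1 by algebra
  then show ?thesis using \<open>c \<noteq> 0\<close> by simp
qed

end

section \<open>Jordan chains and algebraic multiplicity\<close>

lemma jordan_chain_take:
  assumes "jordan_chain L lam m \<xi>" "1 \<le> n" "n \<le> m"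
  shows "jordan_chain L lam n \<xi>"
  using assms unfolding jordan_chain_def by auto

text \<open>Initial segments of Jordan chains are Jordan chains, so a supremum of at least \<open>n\<close> is witnessed by a
chain of length exactly \<open>n\<close>.\<close>

lemma alg_mult_ge_iff:
  assumes "n \<ge> 1"
  shows "alg_mult L lam \<ge> enat n \<longleftrightarrow> (\<exists>\<xi>. jordan_chain L lam n \<xi>)"
proof
  assume "\<exists>\<xi>. jordan_chain L lam n \<xi>"
  then show "alg_mult L lam \<ge> enat n"
    unfolding alg_mult_def by (intro Sup_upper) blast
next
  assume ge: "alg_mult L lam \<ge> enat n"
  show "\<exists>\<xi>. jordan_chain L lam n \<xi>"
  proof (rule ccontr)
    assume *: "\<not> ?thesis"
    have "alg_mult L lam \<le> enat (n - 1)"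
      unfolding alg_mult_def
    proof (rule Sup_least, clarify)
      fix m \<xi> assume "jordan_chain L lam m \<xi>"
      then have "\<not> n \<le> m" using * jordan_chain_take[OF _ assms] by blast
      then show "enat m \<le> enat (n - 1)" by simp
    qed
    then have "enat n \<le> enat (n - 1)" using ge by (rule order_trans[rotated])
    with assms show False by simp
  qed
qed

text \<open>The last summand keeps the shape of the left-hand side, so that the rule can be iterated.\<close>

lemma deriv_polynomial4:
  "deriv (\<lambda>x. a + x * b + x\<^sup>2 * c + x ^ 3 * d + x ^ 4 * e) =
   (\<lambda>x. b + x * (2 * c) + x\<^sup>2 * (3 * d) + x ^ 3 * (4 * e) + x ^ 4 * (0::complex))"
  by (rule ext, rule DERIV_imp_deriv) (auto intro!: derivative_eq_intros simp: power2_eq_square eval_nat_numeral algebra_simps)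

lemma shifted_deriv_eq_ddz: "shifted_deriv k lam v = (\<lambda>z. lam * v z + of_real k * ddz v z)"
  by (simp add: shifted_deriv_def[abs_def] ddz_def)

lemma smooth_periodic_shifted_deriv:
  "smooth_periodic v \<Longrightarrow> smooth_periodic (shifted_deriv k lam v)"
  unfolding shifted_deriv_eq_ddz by (intro smooth_periodic_intros)

lemma ddz_shifted_deriv:
  assumes "smooth_periodic v"
  shows "ddz (shifted_deriv k lam v) = shifted_deriv k lam (ddz v)"
proof -
  note c = ddz_iter_cmult[where i=1, simplified]
  have "ddz (\<lambda>z. lam * v z + of_real k * ddz v z) = (\<lambda>z. ddz (\<lambda>z. lam * v z) z + ddz (\<lambda>z. of_real k * ddz v z) z)"
    using ddz_iter_add[of "\<lambda>z. lam * v z" "\<lambda>z. of_real k * ddz v z" 1] assms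
    by (simp add: smooth_periodic_intros)
  then show ?thesis
    unfolding shifted_deriv_eq_ddz using c assms smooth_periodic_ddz by simp
qed

lemma shifted_deriv_2:
  assumes "smooth_periodic v"
  shows "(shifted_deriv k lam ^^ 2) v z = lam\<^sup>2 * v z + 2 * lam * of_real k * ddz v z + of_real k ^ 2 * (ddz ^^ 2) v z"
proof -
  have "(shifted_deriv k lam ^^ 2) v z =
    lam * shifted_deriv k lam v z + of_real k * ddz (shifted_deriv k lam v) z"
    by (simp add: eval_nat_numeral shifted_deriv_eq_ddz[of k lam "shifted_deriv k lam v"])
  then show ?thesis
    unfolding ddz_shifted_deriv[OF assms]
    by (simp add: shifted_deriv_eq_ddz eval_nat_numeral algebra_simps)
qed

lemma shifted_deriv_4:
  assumes v: "smooth_periodic v"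
  shows "(shifted_deriv k lam ^^ 4) v z = lam ^ 4 * v z + 4 * lam ^ 3 * of_real k * ddz v z
    + 6 * lam\<^sup>2 * of_real k ^ 2 * (ddz ^^ 2) v z + 4 * lam * of_real k ^ 3 * (ddz ^^ 3) v z
    + of_real k ^ 4 * (ddz ^^ 4) v z"
proof -
  let ?M = "shifted_deriv k lam"
  have M4: "(?M ^^ 4) v = (?M ^^ 2) ((?M ^^ 2) v)" by (simp add: eval_nat_numeral)
  have d: "ddz ((?M ^^ 2) v) = (?M ^^ 2) (ddz v)" "(ddz ^^ 2) ((?M ^^ 2) v) = (?M ^^ 2) ((ddz ^^ 2) v)"
    using v by (simp_all add: eval_nat_numeral ddz_shifted_deriv smooth_periodic_shifted_deriv smooth_periodic_ddz)
  have sp: "smooth_periodic ((?M ^^ 2) v)"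
    using v by (simp add: eval_nat_numeral smooth_periodic_shifted_deriv)
  show ?thesis
    unfolding M4 shifted_deriv_2[OF sp] d
      shifted_deriv_2[OF v] shifted_deriv_2[OF smooth_periodic_ddz[OF v]]
      shifted_deriv_2[OF smooth_periodic_ddz_iter[OF v]]
    by (simp add: eval_nat_numeral algebra_simps)
qed

context periodic_operator
begin

context
  fixes V :: "real \<Rightarrow> real" and u :: "real \<Rightarrow> real \<Rightarrow> real"
  assumes q: "\<And>z. (deriv ^^ 2) V (u z k) = q z"
begin

lemma L_op_expansion:
  assumes "smooth_periodic v"
  shows "L_op \<sigma> V u k lam v z = L0 v z + lam * L1 v z + lam\<^sup>2 * L2 v z + lam ^ 3 * L3 v z + lam ^ 4 * v z"
  unfolding L_op_def shifted_deriv_4[OF assms] shifted_deriv_2[OF assms] q L0_def L1_def L2_def L3_def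
  by (simp add: algebra_simps)

lemma L_op_zero: "smooth_periodic v \<Longrightarrow> L_op \<sigma> V u k 0 v z = L0 v z"
  by (simp add: L_op_expansion)

lemma param_deriv_L_op:
  assumes "smooth_periodic v"
  shows "param_deriv 1 (L_op \<sigma> V u k) 0 v z = L1 v z"
    and "param_deriv 2 (L_op \<sigma> V u k) 0 v z = 2 * L2 v z"
    and "param_deriv 3 (L_op \<sigma> V u k) 0 v z = 6 * L3 v z"
proof -
  have iter: "(deriv ^^ 1) f = deriv f" "(deriv ^^ 2) f = deriv (deriv f)"
    "(deriv ^^ 3) f = deriv (deriv (deriv f))" for f :: "complex \<Rightarrow> complex"
    by (simp_all add: eval_nat_numeral)
  show "param_deriv 1 (L_op \<sigma> V u k) 0 v z = L1 v z"
    "param_deriv 2 (L_op \<sigma> V u k) 0 v z = 2 * L2 v z"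
    "param_deriv 3 (L_op \<sigma> V u k) 0 v z = 6 * L3 v z"
    unfolding param_deriv_def L_op_expansion[OF assms] iter deriv_polynomial4 by simp_all
qed

lemma jordan_chain_3_iff:
  "jordan_chain (L_op \<sigma> V u k) 0 3 \<xi> \<longleftrightarrow>
    smooth_periodic (\<xi> 1) \<and> smooth_periodic (\<xi> 2) \<and> smooth_periodic (\<xi> 3) \<and> \<xi> 1 \<noteq> (\<lambda>z. 0) \<and>
    (\<forall>z. L0 (\<xi> 1) z = 0) \<and> (\<forall>z. L0 (\<xi> 2) z = - L1 (\<xi> 1) z) \<and>
    (\<forall>z. L0 (\<xi> 3) z = - (L1 (\<xi> 2) z + L2 (\<xi> 1) z))"
proof -
  have "{1..3} = {1, 2, 3::nat}" "{1..1} = {1::nat}" "{1..2} = {1, 2::nat}" by auto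
  then show ?thesis
    unfolding jordan_chain_def
    by (auto simp: L_op_zero param_deriv_L_op param_deriv_L_op(1)[unfolded One_nat_def])
qed

lemma jordan_chain_4_iff:
  "jordan_chain (L_op \<sigma> V u k) 0 4 \<xi> \<longleftrightarrow>
    jordan_chain (L_op \<sigma> V u k) 0 3 \<xi> \<and> smooth_periodic (\<xi> 4) \<and>
    (\<forall>z. L0 (\<xi> 4) z = - (L1 (\<xi> 3) z + L2 (\<xi> 2) z + L3 (\<xi> 1) z))"
proof -
  have "{1..4} = {1, 2, 3, 4::nat}" "{1..3} = {1, 2, 3::nat}" by auto
  then show ?thesis
    unfolding jordan_chain_def
    by (auto simp: L_op_zero param_deriv_L_op param_deriv_L_op(1)[unfolded One_nat_def] fact_numeral add.assoc)
qed

lemma jordan_chain_2_iff: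
  "jordan_chain (L_op \<sigma> V u k) 0 2 \<xi> \<longleftrightarrow>
    smooth_periodic (\<xi> 1) \<and> smooth_periodic (\<xi> 2) \<and> \<xi> 1 \<noteq> (\<lambda>z. 0) \<and>
    (\<forall>z. L0 (\<xi> 1) z = 0) \<and> (\<forall>z. L0 (\<xi> 2) z = - L1 (\<xi> 1) z)"
proof -
  have "{1..2} = {1, 2::nat}" by auto
  then show ?thesis
    unfolding jordan_chain_def
    by (auto simp: L_op_zero param_deriv_L_op param_deriv_L_op(1)[unfolded One_nat_def])
qed

text \<open>Here \<open>\<psi>\<close> extends the chain started by \<open>\<phi>\<close>. An arbitrary chain starts with a nonzero multiple of \<open>\<phi>\<close>,
because the kernel is one-dimensional, and \<open>chain_obstruction\<close> applies to it.\<close>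

theorem alg_mult_criterion:
  assumes \<phi>: "smooth_periodic \<phi>" "\<And>z. L0 \<phi> z = 0" "\<phi> \<noteq> (\<lambda>z. 0)"
    and kernel: "\<And>v. smooth_periodic v \<Longrightarrow> (\<And>z. L0 v z = 0) \<Longrightarrow> \<exists>c. v = (\<lambda>z. c * \<phi> z)"
    and \<psi>: "smooth_periodic \<psi>" "\<And>z. L0 \<psi> z = - L1 \<phi> z"
  defines "\<mu> \<equiv> alg_mult (L_op \<sigma> V u k) 0"
  shows "\<mu> \<ge> 2" and "\<mu> \<ge> 3 \<longleftrightarrow> pairing \<phi> (L1 \<psi>) + pairing \<phi> (L2 \<phi>) = 0" and "\<mu> \<ge> 3 \<longrightarrow> \<mu> \<ge> 4"
proof -
  let ?L = "L_op \<sigma> V u k" and ?a = "pairing \<phi> (L1 \<psi>) + pairing \<phi> (L2 \<phi>)"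
  have iff: "\<mu> \<ge> numeral n \<longleftrightarrow> (\<exists>\<xi>. jordan_chain ?L 0 (numeral n) \<xi>)" for n
    using alg_mult_ge_iff[of "numeral n"] by (simp add: \<mu>_def numeral_eq_enat)
  have "jordan_chain ?L 0 2 (\<lambda>j. if j = 1 then \<phi> else \<psi>)"
    using \<phi> \<psi> by (simp add: jordan_chain_2_iff)
  then show "\<mu> \<ge> 2" unfolding iff by blast
  have obstruction: "?a = 0" if "\<mu> \<ge> 3"
  proof -
    from that obtain \<xi> where \<xi>: "jordan_chain ?L 0 3 \<xi>" unfolding iff by blast
    then obtain c where c: "\<xi> 1 = (\<lambda>z. c * \<phi> z)"
      using kernel[of "\<xi> 1"] by (auto simp: jordan_chain_3_iff)
    with \<xi> have "c \<noteq> 0" by (auto simp: jordan_chain_3_iff)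
    then show ?thesis
      using chain_obstruction[OF \<phi>(1,2) \<psi>, of c "\<xi> 2" "\<xi> 3"] \<xi> unfolding jordan_chain_3_iff c
      by blast
  qed
  have extension: "\<mu> \<ge> 4" if solvable: "?a = 0"
  proof -
    obtain \<zeta> \<omega> where *: "smooth_periodic \<zeta>" "\<forall>z. L0 \<zeta> z = - (L1 \<psi> z + L2 \<phi> z)"
      "smooth_periodic \<omega>" "\<forall>z. L0 \<omega> z = - (L1 \<zeta> z + L2 \<psi> z + L3 \<phi> z)"
      using chain_extension[OF \<phi>(1,2) kernel \<psi> solvable] by blast
    have "jordan_chain ?L 0 4
      (\<lambda>j. if j = 1 then \<phi> else if j = 2 then \<psi> else if j = 3 then \<zeta> else \<omega>)"
      using \<phi> \<psi> * by (simp add: jordan_chain_4_iff jordan_chain_3_iff)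
    then show ?thesis unfolding iff by blast
  qed
  moreover have "\<mu> \<ge> 3" if "\<mu> \<ge> 4"
    using that by (rule order_trans[rotated]) simp
  ultimately show "\<mu> \<ge> 3 \<longleftrightarrow> ?a = 0" and "\<mu> \<ge> 3 \<longrightarrow> \<mu> \<ge> 4"
    using obstruction by blast+
qed

end

end

section \<open>The action and the solvability condition\<close>

lemma ddz_iter_section:
  fixes g :: "real \<times> real \<Rightarrow> real"
  assumes g: "smooth_on (UNIV \<times> I) g" and "\<kappa> \<in> I"
  shows "(ddz ^^ i) (\<lambda>z. complex_of_real (g (z, \<kappa>))) = (\<lambda>z. complex_of_real ((partial1 ^^ i) g (z, \<kappa>)))"
proof (induction i)
  case (Suc i)
  have "((\<lambda>z. complex_of_real ((partial1 ^^ i) g (z, \<kappa>))) has_vector_derivative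
      complex_of_real ((partial1 ^^ Suc i) g (z, \<kappa>))) (at z)" for z
    using partial1_has_derivative[OF smooth_on_partial1_iter[OF g, of i], of z \<kappa>] \<open>\<kappa> \<in> I\<close>
    by (intro has_vector_derivative_of_real) (simp add: has_real_derivative_iff_has_vector_derivative)
  then show ?case using Suc by (simp add: ddz_eqI)
qed simp

lemma smooth_periodic_section:
  fixes g :: "real \<times> real \<Rightarrow> real"
  assumes g: "smooth_on (UNIV \<times> I) g" and "\<kappa> \<in> I"
    and "\<And>z. g (z + 2 * pi, \<kappa>) = g (z, \<kappa>)"
  shows "smooth_periodic (\<lambda>z. complex_of_real (g (z, \<kappa>)))"
  using smooth_bounded_linear[OF bounded_linear_of_real smooth_section[OF g \<open>\<kappa> \<in> I\<close>]] assms(3)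
  by (simp add: smooth_periodic_def)

lemma pairing_of_real:
  assumes "continuous_on UNIV a" "continuous_on UNIV b"
  shows "pairing (\<lambda>z. complex_of_real (a z)) (\<lambda>z. complex_of_real (b z)) =
    complex_of_real (integral {0..2 * pi} (\<lambda>z. a z * b z))"
proof -
  have "(\<lambda>z. a z * b z) integrable_on {0..2 * pi}"
    by (intro integrable_continuous_real continuous_intros continuous_on_subset[OF assms(1)]
        continuous_on_subset[OF assms(2)]) auto
  from integral_linear[OF this bounded_linear_of_real[where 'a=complex]] show ?thesis
    by (simp add: pairing_def o_def)
qed

text \<open>Differentiation under the integral sign, after splitting off the explicit powers of the parameter.
The derivative of \<open>(\<partial>\<^sub>z\<^sup>i u)\<^sup>2\<close> in \<open>\<kappa>\<close> involves \<open>W i\<close> because the partial derivatives commute.\<close>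

lemma action_has_derivative:
  fixes u :: "real \<Rightarrow> real \<Rightarrow> real"
  defines "f \<equiv> \<lambda>(z, \<kappa>). u z \<kappa>"
  assumes f: "smooth_on (UNIV \<times> I) f" and I: "open I" "is_interval I" "k \<in> I"
  defines "U \<equiv> \<lambda>i z. (partial1 ^^ i) f (z, k)" and "W \<equiv> \<lambda>i z. (partial1 ^^ i) (partial2 f) (z, k)"
  shows "(action \<sigma> u has_real_derivative 1 / (2 * pi) *
    (\<sigma> * integral {0..2 * pi} (\<lambda>z. U 1 z * U 1 z) + 2 * \<sigma> * k * integral {0..2 * pi} (\<lambda>z. U 1 z * W 1 z)
     - 6 * k\<^sup>2 * integral {0..2 * pi} (\<lambda>z. U 2 z * U 2 z) - 4 * k ^ 3 * integral {0..2 * pi} (\<lambda>z. U 2 z * W 2 z))) (at k)"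
proof -
  define J where "J i \<kappa> = integral {0..2 * pi} (\<lambda>z. ((partial1 ^^ i) f (z, \<kappa>))\<^sup>2)" for i \<kappa>
  have J: "(J i has_real_derivative 2 * integral {0..2 * pi} (\<lambda>z. U i z * W i z)) (at k)" for i
  proof -
    let ?g = "(partial1 ^^ i) f"
    have g: "smooth_on (UNIV \<times> I) ?g" by (rule smooth_on_partial1_iter[OF f])
    have "(J i has_real_derivative integral {0..2 * pi} (\<lambda>z. 2 * ?g (z, k) * partial2 ?g (z, k))) (at k)"
      unfolding J_def
    proof (rule integral_param_has_derivative[where f="\<lambda>p. (?g p)\<^sup>2" and f'="\<lambda>p. 2 * ?g p * partial2 ?g p" and I=I])
      show "((\<lambda>x. (?g (z, x))\<^sup>2) has_real_derivative 2 * ?g (z, x) * partial2 ?g (z, x)) (at x)"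
        if "x \<in> I" for z x
        using partial2_has_derivative[OF g, of z x] that by (auto intro!: derivative_eq_intros)
      show "continuous_on (UNIV \<times> I) (\<lambda>p. (?g p)\<^sup>2)"
        "continuous_on (UNIV \<times> I) (\<lambda>p. 2 * ?g p * partial2 ?g p)"
        by (intro continuous_intros smooth_on_frechet(3)[OF g] smooth_on_frechet(3)[OF smooth_on_partial(2)[OF g]])+
    qed (fact I)+
    also have "(\<lambda>z. 2 * ?g (z, k) * partial2 ?g (z, k)) = (\<lambda>z. 2 * (U i z * W i z))"
      using partial_commute_iter[OF f I, of i] by (simp add: U_def W_def mult.assoc)
    finally show ?thesis by simp
  qed
  have action_eq: "1 / (2 * pi) * (\<sigma> * \<kappa> * J 1 \<kappa> - 2 * \<kappa> ^ 3 * J 2 \<kappa>) = action \<sigma> u \<kappa>" if "\<kappa> \<in> I" for \<kappa>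
  proof -
    have d: "(deriv ^^ i) (\<lambda>z. u z \<kappa>) z = (partial1 ^^ i) f (z, \<kappa>)" for i z
      using fun_cong[OF deriv_iter_section[OF f that]] by (simp add: f_def)
    have c: "continuous_on X (\<lambda>z. (partial1 ^^ i) f (z, \<kappa>))" for X i
      by (rule smooth_real_continuous[OF smooth_section[OF smooth_on_partial1_iter[OF f] that]])
    have "integral {0..2 * pi} (\<lambda>z. \<sigma> * \<kappa> * ((partial1 ^^ 1) f (z, \<kappa>))\<^sup>2 - 2 * \<kappa> ^ 3 * ((partial1 ^^ 2) f (z, \<kappa>))\<^sup>2)
      = integral {0..2 * pi} (\<lambda>z. \<sigma> * \<kappa> * ((partial1 ^^ 1) f (z, \<kappa>))\<^sup>2)
        - integral {0..2 * pi} (\<lambda>z. 2 * \<kappa> ^ 3 * ((partial1 ^^ 2) f (z, \<kappa>))\<^sup>2)"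
      by (intro integral_diff integrable_continuous_real continuous_intros c)
    then show ?thesis
      unfolding action_def d[of 1, simplified] d[of 2] J_def by simp
  qed
  have "((\<lambda>\<kappa>. 1 / (2 * pi) * (\<sigma> * \<kappa> * J 1 \<kappa> - 2 * \<kappa> ^ 3 * J 2 \<kappa>)) has_real_derivative
    1 / (2 * pi) * ((\<sigma> * k * (2 * integral {0..2 * pi} (\<lambda>z. U 1 z * W 1 z)) + \<sigma> * J 1 k)
      - (2 * k ^ 3 * (2 * integral {0..2 * pi} (\<lambda>z. U 2 z * W 2 z)) + 6 * k\<^sup>2 * J 2 k))) (at k)"
    by (intro DERIV_cmult DERIV_diff)
      (auto intro!: derivative_eq_intros J simp: power2_eq_square eval_nat_numeral)
  then have "(action \<sigma> u has_real_derivative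
    1 / (2 * pi) * ((\<sigma> * k * (2 * integral {0..2 * pi} (\<lambda>z. U 1 z * W 1 z)) + \<sigma> * J 1 k)
      - (2 * k ^ 3 * (2 * integral {0..2 * pi} (\<lambda>z. U 2 z * W 2 z)) + 6 * k\<^sup>2 * J 2 k))) (at k)"
    by (rule has_field_derivative_transform_within_open[OF _ I(1,3)]) (rule action_eq)
  then show ?thesis
    by (rule DERIV_cong) (simp add: J_def U_def power2_eq_square algebra_simps)
qed

context periodic_operator
begin

text \<open>The obstruction to a third chain equation, written so that each term matches one of
\<open>action_has_derivative\<close>.\<close>

lemma solvability_by_parts:
  assumes \<phi>: "smooth_periodic \<phi>" and \<psi>: "smooth_periodic \<psi>"
  shows "pairing \<phi> (L1 \<psi>) + pairing \<phi> (L2 \<phi>) =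
    of_real \<sigma> * pairing \<phi> \<phi> + of_real (2 * \<sigma> * k) * pairing \<phi> (ddz \<psi>)
    - of_real (6 * k\<^sup>2) * pairing (ddz \<phi>) (ddz \<phi>) - of_real (4 * k ^ 3) * pairing (ddz \<phi>) ((ddz ^^ 2) \<psi>)"
proof -
  have 1: "pairing \<phi> (L1 \<psi>) = of_real (4 * k ^ 3) * pairing \<phi> ((ddz ^^ 3) \<psi>)
      + of_real (2 * \<sigma> * k) * pairing \<phi> (ddz \<psi>)"
    unfolding L1_def[abs_def] by (intro pairing_combine smooth_periodic_intros \<phi> \<psi>)
  have 2: "pairing \<phi> (L2 \<phi>) = of_real (6 * k\<^sup>2) * pairing \<phi> ((ddz ^^ 2) \<phi>) + of_real \<sigma> * pairing \<phi> \<phi>"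
    unfolding L2_def[abs_def] by (intro pairing_combine smooth_periodic_intros \<phi> \<psi>)
  have 3: "pairing \<phi> ((ddz ^^ 3) \<psi>) = - pairing (ddz \<phi>) ((ddz ^^ 2) \<psi>)"
    using pairing_ddz[OF \<phi> smooth_periodic_ddz_iter[OF \<psi>], of 2] by (simp add: eval_nat_numeral)
  have 4: "pairing \<phi> ((ddz ^^ 2) \<phi>) = - pairing (ddz \<phi>) (ddz \<phi>)"
    using pairing_ddz[OF \<phi> smooth_periodic_ddz[OF \<phi>]] by (simp add: eval_nat_numeral)
  show ?thesis unfolding 1 2 3 4 by (simp add: algebra_simps)
qed

end

theorem proposition3p5:
  fixes \<sigma> :: real and V :: "real \<Rightarrow> real" and u :: "real \<Rightarrow> real \<Rightarrow> real"
    and I :: "real set" and k :: real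
  assumes "smooth_on UNIV V"
    and "open I" and "is_interval I" and "0 \<notin> I"
    and "smooth_on (UNIV \<times> I) (\<lambda>(z, \<kappa>). u z \<kappa>)"
    and "\<forall>\<kappa>\<in>I. \<forall>z. u (z + 2 * pi) \<kappa> = u z \<kappa>"
    and "\<forall>\<kappa>\<in>I. \<not> (\<lambda>z. u z \<kappa>) constant_on UNIV"
    and "\<forall>\<kappa>\<in>I. \<forall>z. \<kappa> ^ 4 * (deriv ^^ 4) (\<lambda>z. u z \<kappa>) z
           + \<sigma> * \<kappa>\<^sup>2 * (deriv ^^ 2) (\<lambda>z. u z \<kappa>) z + deriv V (u z \<kappa>) = 0"
    and "k \<in> I"
    and "periodic_kernel (L_op \<sigma> V u k 0) = {\<lambda>z. c * of_real (deriv (\<lambda>z. u z k) z) | c. True}"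
  shows "alg_mult (L_op \<sigma> V u k) 0 \<ge> 2
    \<and> (alg_mult (L_op \<sigma> V u k) 0 \<ge> 3 \<longleftrightarrow> deriv (action \<sigma> u) k = 0)
    \<and> (alg_mult (L_op \<sigma> V u k) 0 \<ge> 3 \<longrightarrow> alg_mult (L_op \<sigma> V u k) 0 \<ge> 4)"
proof -
  define f where "f = (\<lambda>(z, \<kappa>). u z \<kappa>)"
  define U where "U i z = (partial1 ^^ i) f (z, k)" for i z
  define W where "W i z = (partial1 ^^ i) (partial2 f) (z, k)" for i z
  define q where "q z = (deriv ^^ 2) V (u z k)" for z
  note I = assms(2,3,9)
  have f: "smooth_on (UNIV \<times> I) f" using assms(5) by (simp add: f_def)
  note f2 = smooth_on_partial(2)[OF f]
  have f_eq: "f (z, \<kappa>) = u z \<kappa>" for z \<kappa> by (simp add: f_def)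
  have u_deriv: "(deriv ^^ i) (\<lambda>z. u z \<kappa>) z = (partial1 ^^ i) f (z, \<kappa>)" if "\<kappa> \<in> I" for i \<kappa> z
    using fun_cong[OF deriv_iter_section[OF f that]] by (simp add: f_eq)
  have V1: "smooth_on UNIV (deriv V)" using smooth_real_deriv[OF assms(1)] by simp
  have u_smooth: "smooth_on UNIV (\<lambda>z. u z k)"
    using smooth_section[OF f I(3)] by (simp add: f_eq)

  interpret periodic_operator k \<sigma> q
  proof
    show "k \<noteq> 0" using assms(4,9) by blast
    show "smooth_on UNIV q"
      unfolding q_def[abs_def]
      using smooth_real_compose[OF u_smooth smooth_real_deriv(1)[OF V1]] by (simp add: numeral_2_eq_2)
    show "q (z + 2 * pi) = q z" for z using assms(6,9) by (simp add: q_def)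
  qed

  define \<phi> where "\<phi> z = complex_of_real (U 1 z)" for z
  define \<psi> where "\<psi> z = complex_of_real (W 0 z)" for z
  have kernel_eq: "periodic_kernel (L_op \<sigma> V u k 0) = {\<lambda>z. c * \<phi> z | c. True}"
    using assms(10) u_deriv[OF I(3), of 1] by (simp add: \<phi>_def U_def)
  have "\<phi> \<in> periodic_kernel (L_op \<sigma> V u k 0)"
    unfolding kernel_eq by (auto intro!: exI[of _ 1])
  then have \<phi>: "smooth_periodic \<phi>" "\<And>z. L0 \<phi> z = 0"
    unfolding periodic_kernel_def using L_op_zero[where V=V and u=u, OF q_def[symmetric]] by auto
  have kernel: "\<exists>c. v = (\<lambda>z. c * \<phi> z)" if "smooth_periodic v" "\<And>z. L0 v z = 0" for v
  proof -
    have "v \<in> periodic_kernel (L_op \<sigma> V u k 0)"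
      unfolding periodic_kernel_def using that L_op_zero[where V=V and u=u, OF q_def[symmetric]] by auto
    then show ?thesis unfolding kernel_eq by blast
  qed
  \<comment> \<open>otherwise the profile would be constant\<close>
  have \<phi>_nonzero: "\<phi> \<noteq> (\<lambda>z. 0)"
  proof
    assume "\<phi> = (\<lambda>z. 0)"
    then have "U 1 z = 0" for z unfolding \<phi>_def by (metis of_real_eq_0_iff)
    then have "((\<lambda>z. u z k) has_real_derivative 0) (at z)" for z
      using partial1_has_derivative[OF f, of z k] I(3) by (simp add: U_def f_eq)
    then have "(\<lambda>z. u z k) constant_on UNIV"
      unfolding constant_on_def using DERIV_isconst_all[of "\<lambda>z. u z k"] by blast
    then show False using assms(7) I(3) by blast
  qed
  have \<psi>_periodic: "partial2 f (z + 2 * pi, k) = partial2 f (z, k)" for z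
  proof -
    have "((\<lambda>\<kappa>. f (z, \<kappa>)) has_real_derivative partial2 f (z + 2 * pi, k)) (at k)"
      by (rule has_field_derivative_transform_within_open[OF partial2_has_derivative[OF f] I(1,3)])
        (use I(3) assms(6) in \<open>auto simp: f_eq\<close>)
    then show ?thesis
      using partial2_has_derivative[OF f, of z k] I(3) DERIV_unique by blast
  qed
  have \<psi>_smooth: "smooth_periodic \<psi>"
    unfolding \<psi>_def[abs_def] W_def using smooth_periodic_section[OF f2 I(3) \<psi>_periodic] by simp
  have ddz_\<phi>: "(ddz ^^ i) \<phi> = (\<lambda>z. complex_of_real (U (Suc i) z))" for i
    using ddz_iter_section[OF smooth_on_partial(1)[OF f] I(3), of i]
    by (simp add: \<phi>_def[abs_def] U_def funpow_swap1)
  have ddz_\<psi>: "(ddz ^^ i) \<psi> = (\<lambda>z. complex_of_real (W i z))" for i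
    using ddz_iter_section[OF f2 I(3), of i] by (simp add: \<psi>_def[abs_def] W_def)
  \<comment> \<open>the profile equation differentiated in the parameter\<close>
  have \<psi>_eq: "L0 \<psi> z = - L1 \<phi> z" for z
  proof -
    have dU: "((\<lambda>\<kappa>. (partial1 ^^ i) f (z, \<kappa>)) has_real_derivative W i z) (at k)" for i
      using partial2_has_derivative[OF smooth_on_partial1_iter[OF f, of i], of z k] I(3)
        partial_commute_iter[OF f I, of i z] by (simp add: W_def)
    have dV: "((\<lambda>\<kappa>. deriv V (u z \<kappa>)) has_real_derivative q z * W 0 z) (at k)"
      using DERIV_chain2[OF smooth_real_deriv(2)[OF V1] dU[of 0, simplified f_eq funpow_0]]
      by (simp add: q_def numeral_2_eq_2)
    have "((\<lambda>\<kappa>. \<kappa> ^ 4 * (partial1 ^^ 4) f (z, \<kappa>) + \<sigma> * \<kappa>\<^sup>2 * (partial1 ^^ 2) f (z, \<kappa>) + deriv V (u z \<kappa>))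
      has_real_derivative 4 * k ^ 3 * U 4 z + k ^ 4 * W 4 z + (\<sigma> * (2 * k) * U 2 z + \<sigma> * k\<^sup>2 * W 2 z) + q z * W 0 z) (at k)"
      by (rule derivative_eq_intros dU dV refl | simp add: U_def)+
    moreover have "((\<lambda>\<kappa>. \<kappa> ^ 4 * (partial1 ^^ 4) f (z, \<kappa>) + \<sigma> * \<kappa>\<^sup>2 * (partial1 ^^ 2) f (z, \<kappa>) + deriv V (u z \<kappa>))
      has_real_derivative 0) (at k)"
      by (rule has_field_derivative_transform_within_open[OF DERIV_const[of 0] I(1,3)])
        (use assms(8) u_deriv in force)
    ultimately have "4 * k ^ 3 * U 4 z + k ^ 4 * W 4 z + (\<sigma> * (2 * k) * U 2 z + \<sigma> * k\<^sup>2 * W 2 z) + q z * W 0 z = 0"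
      by (rule DERIV_unique)
    then have "k ^ 4 * W 4 z + \<sigma> * k\<^sup>2 * W 2 z + q z * W 0 z = - (4 * k ^ 3 * U 4 z + 2 * \<sigma> * k * U 2 z)"
      by (simp add: algebra_simps)
    moreover have "L0 \<psi> z = of_real (k ^ 4 * W 4 z + \<sigma> * k\<^sup>2 * W 2 z + q z * W 0 z)"
      unfolding L0_def ddz_\<psi> by (simp add: \<psi>_def)
    moreover have "L1 \<phi> z = of_real (4 * k ^ 3 * U 4 z + 2 * \<sigma> * k * U 2 z)"
      unfolding L1_def using ddz_\<phi>[of 3] ddz_\<phi>[of 1] by (simp add: eval_nat_numeral)
    ultimately show ?thesis by simp
  qed

  have cont: "continuous_on UNIV (U i)" "continuous_on UNIV (W i)" for i
    unfolding U_def[abs_def] W_def[abs_def]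
    by (rule smooth_real_continuous[OF smooth_section[OF smooth_on_partial1_iter[OF f] I(3)]]
        smooth_real_continuous[OF smooth_section[OF smooth_on_partial1_iter[OF f2] I(3)]])+
  note of_real = pairing_of_real[OF cont(1) cont(1)] pairing_of_real[OF cont(1) cont(2)]
  have "pairing \<phi> (L1 \<psi>) + pairing \<phi> (L2 \<phi>) = of_real
    (\<sigma> * integral {0..2 * pi} (\<lambda>z. U 1 z * U 1 z) + 2 * \<sigma> * k * integral {0..2 * pi} (\<lambda>z. U 1 z * W 1 z)
     - 6 * k\<^sup>2 * integral {0..2 * pi} (\<lambda>z. U 2 z * U 2 z) - 4 * k ^ 3 * integral {0..2 * pi} (\<lambda>z. U 2 z * W 2 z))"
  proof -
    have D: "ddz \<phi> = (\<lambda>z. complex_of_real (U 2 z))" "ddz \<psi> = (\<lambda>z. complex_of_real (W 1 z))"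
      using ddz_\<phi>[of 1] ddz_\<psi>[of 1] by (simp_all add: numeral_2_eq_2)
    show ?thesis
      unfolding solvability_by_parts[OF \<phi>(1) \<psi>_smooth]
      unfolding D ddz_\<psi> unfolding \<phi>_def[abs_def] of_real
      by simp
  qed
  also have "\<dots> = of_real (2 * pi * deriv (action \<sigma> u) k)"
    using DERIV_imp_deriv[OF action_has_derivative[OF f[unfolded f_def] I, of \<sigma>]]
    by (simp add: U_def W_def f_def)
  finally have "pairing \<phi> (L1 \<psi>) + pairing \<phi> (L2 \<phi>) = 0 \<longleftrightarrow> deriv (action \<sigma> u) k = 0"
    by simp
  with alg_mult_criterion[where V=V and u=u, OF q_def[symmetric] \<phi> \<phi>_nonzero kernel \<psi>_smooth \<psi>_eq]
  show ?thesis by blast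
qed

end
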